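(* There is a constant $c>0$ such that for all integers $\ell,k,d\ge0$ with $4\le\ell\le\frac{d-2}{2}$ and $\ell+2k+2\le d$, the following holds. Let $X$ be a $d$-dimensional $\frac{1}{\ell(k+\ell)^2}$-two-sided link expander. Let $\Sigma$ be a finite alphabet and let $\{f_z:\mathrm{Ball}_z\to\Sigma\}_{z\in X(k)}$ be an ensemble, where $\mathrm{Ball}_z=\{v\in X(0)\setminus z: z\cup\{v\}\in X\}$. Let $\varepsilon$ be the rejection probability of either the weak independent agreement test or the weak complement agreement test. Then there is $G:X(0)\to\Sigma$ with $$\Pr_{z\in X(k)}\Big[\Pr_{v}[f_z(v)\neq G(v)]>\tfrac1\ell\Big]\le c\,\varepsilon,$$ where $v$ is distributed according to the vertex measure of the link $X_z$.
   Context: **Weighted simplicial complexes.** $X(j)$ denotes the faces of size $j+1$ of a $d$-dimensional simplicial complex $X$, weighted by a distribution on $X(d)$ (choose a $d$-face, then a uniform chain of subfaces). The link of $t$ is $X_t=\{u\setminus t:t\subseteq u\in X\}$, with $\Pr_{X_t}[u]=\Pr[u\cup t\mid t]$. **Expansion.** $X$ is a $\lambda$-two-sided link expander if for every face $s$ of size at most $d-1$ (including $\emptyset$), the random-walk operator of the underlying graph of $X_s$ (vertices $X_s(0)$, edges $X_s(1)$, weighted by the link measure) has all non-top eigenvalues in $[-\lambda,\lambda]$. **Complement walk.** The $(k,k)$-complement walk in a complex $Y$ chooses $u\in Y(2k+1)$ according to the measure and a uniformly random partition $u=z_1\sqcup z_2$ with $|z_1|=|z_2|=k+1$, and outputs $(z_1,z_2)$.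 **Weak agreement tests.** - Weak independent test: sample $t\in X(\ell)$, then $z_1,z_2\in X_t(k)$ independently according to the link measure, and accept iff $f_{z_1}|_t=f_{z_2}|_t$. Note that $t\subseteq\mathrm{Ball}_{z_i}$. - Weak complement test: sample $t\in X(\ell)$, then $(z_1,z_2)$ by the $(k,k)$-complement walk in $X_t$, and accept iff $f_{z_1}|_t=f_{z_2}|_t$. *)

theory Defs
  imports "Jordan_Normal_Form.Char_Poly"
begin

text \<open>A d-dimensional weighted complex is given by its distribution w on the
top faces X(d) (sets of d+1 vertices).  The faces of X are all subsets of
top faces of positive weight (the complex is the downward closure).\<close>

definition supp :: "('v set \<Rightarrow> real) \<Rightarrow> 'v set set" where
  "supp w = {a. w a \<noteq> 0}"

definition wcomplex :: "('v set \<Rightarrow> real) \<Rightarrow> nat \<Rightarrow> bool" where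
  "wcomplex w d \<longleftrightarrow> finite (supp w) \<and> (\<forall>a. 0 \<le> w a) \<and> sum w (supp w) = 1
     \<and> (\<forall>a\<in>supp w. finite a \<and> card a = Suc d)"

definition faces :: "('v set \<Rightarrow> real) \<Rightarrow> 'v set set" where
  "faces w = {s. \<exists>a\<in>supp w. s \<subseteq> a}"

definition lev :: "('v set \<Rightarrow> real) \<Rightarrow> nat \<Rightarrow> 'v set set" where
  "lev w j = {s \<in> faces w. card s = Suc j}"

text \<open>Probability of a face s (of any size) under the induced measure:
choose a top face according to w, then a uniformly random chain of subfaces;
the face of size card s equals s with this probability.\<close>
definition fprob :: "('v set \<Rightarrow> real) \<Rightarrow> nat \<Rightarrow> 'v set \<Rightarrow> real" where
  "fprob w d s = sum w {a \<in> supp w. s \<subseteq> a} / real (Suc d choose card s)"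

text \<open>Top-face distribution of the link X_t (a complex of dimension d - card t):
Pr_{X_t}[u] = Pr[u \<union> t | t].\<close>
definition link :: "('v set \<Rightarrow> real) \<Rightarrow> 'v set \<Rightarrow> 'v set \<Rightarrow> real" where
  "link w t a = (if a \<inter> t = {} then w (a \<union> t) / sum w {b \<in> supp w. t \<subseteq> b} else 0)"

definition verts :: "('v set \<Rightarrow> real) \<Rightarrow> 'v set" where
  "verts w = {v. {v} \<in> faces w}"

definition walk :: "('v set \<Rightarrow> real) \<Rightarrow> nat \<Rightarrow> 'v \<Rightarrow> 'v \<Rightarrow> real" where
  "walk w d v u = (if u = v then 0 else
      fprob w d {v, u} / (\<Sum>u'\<in>verts w - {v}. fprob w d {v, u'}))"

text \<open>Matrix of the random-walk operator w.r.t. some enumeration of the vertices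
(the characteristic polynomial does not depend on the enumeration).\<close>
definition walk_mat :: "('v set \<Rightarrow> real) \<Rightarrow> nat \<Rightarrow> real mat" where
  "walk_mat w d = (let vs = (SOME vs. distinct vs \<and> set vs = verts w)
     in mat (length vs) (length vs) (\<lambda>(i, j). walk w d (vs ! i) (vs ! j)))"

definition nontop_eigs_bounded :: "real mat \<Rightarrow> real \<Rightarrow> bool" where
  "nontop_eigs_bounded A lam \<longleftrightarrow>
     (\<exists>e0 es. char_poly A = [:- e0, 1:] * (\<Prod>e\<leftarrow>es. [:- e, 1:])
        \<and> (\<forall>e\<in>set es. e \<le> e0 \<and> - lam \<le> e \<and> e \<le> lam))"

definition two_sided_link_expander :: "('v set \<Rightarrow> real) \<Rightarrow> nat \<Rightarrow> real \<Rightarrow> bool" where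
  "two_sided_link_expander w d lam \<longleftrightarrow>
     (\<forall>s\<in>faces w. card s \<le> d - 1 \<longrightarrow>
        nontop_eigs_bounded (walk_mat (link w s) (d - card s)) lam)"

definition ball :: "('v set \<Rightarrow> real) \<Rightarrow> 'v set \<Rightarrow> 'v set" where
  "ball w z = {v \<in> verts w. v \<notin> z \<and> z \<union> {v} \<in> faces w}"

definition rej_indep :: "('v set \<Rightarrow> real) \<Rightarrow> nat \<Rightarrow> nat \<Rightarrow> nat
    \<Rightarrow> ('v set \<Rightarrow> 'v \<Rightarrow> 'a) \<Rightarrow> real" where
  "rej_indep w d l k f =
     (\<Sum>t\<in>lev w l. fprob w d t *
        (\<Sum>z1\<in>lev (link w t) k. \<Sum>z2\<in>lev (link w t) k.
            fprob (link w t) (d - card t) z1 * fprob (link w t) (d - card t) z2 *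
            of_bool (\<exists>v\<in>t. f z1 v \<noteq> f z2 v)))"

text \<open>Rejection probability of the weak complement test (using the (k,k)-complement
walk in the link X_t).\<close>
definition rej_compl :: "('v set \<Rightarrow> real) \<Rightarrow> nat \<Rightarrow> nat \<Rightarrow> nat
    \<Rightarrow> ('v set \<Rightarrow> 'v \<Rightarrow> 'a) \<Rightarrow> real" where
  "rej_compl w d l k f =
     (\<Sum>t\<in>lev w l. fprob w d t *
        (\<Sum>u\<in>lev (link w t) (2 * k + 1). fprob (link w t) (d - card t) u *
            ((\<Sum>z1\<in>{z. z \<subseteq> u \<and> card z = Suc k}.
                 of_bool (\<exists>v\<in>t. f z1 v \<noteq> f (u - z1) v))
             / real ((2 * k + 2) choose (k + 1)))))"

definition far_prob :: "('v set \<Rightarrow> real) \<Rightarrow> nat \<Rightarrow> nat \<Rightarrow> nat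
    \<Rightarrow> ('v set \<Rightarrow> 'v \<Rightarrow> 'a) \<Rightarrow> ('v \<Rightarrow> 'a) \<Rightarrow> real" where
  "far_prob w d l k f G =
     (\<Sum>z\<in>lev w k. fprob w d z *
        of_bool ((\<Sum>v\<in>ball w z. fprob (link w z) (d - card z) {v} * of_bool (f z v \<noteq> G v))
                 > 1 / real l))"

end

theory Submission
  imports Defs "Jordan_Normal_Form.Schur_Decomposition"
begin

text \<open>Write \<open>L = l + 1\<close>, \<open>K = k + 1\<close> for the sizes of \<open>t\<close> and \<open>z\<close>.  For every \<open>t\<close> let \<open>g t\<close> be the
  restriction to \<open>t\<close> of some \<open>f z\<close> that agrees on \<open>t\<close> with as many \<open>z\<close> as the average one; call
  \<open>(z, t)\<close> bad if \<open>f z\<close> and \<open>g t\<close> differ on \<open>t\<close>, so bad pairs have probability at most \<open>\<epsilon>\<close>.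
  Fix a vertex \<open>v\<close>.  Two faces \<open>z, z'\<close> with \<open>f z v \<noteq> f z' v\<close> cannot both be good with the same
  \<open>t\<close> containing \<open>v\<close>, so splitting the \<open>z\<close> by their label at \<open>v\<close> gives a cut of the bipartite graph
  of disjoint faces of sizes \<open>K\<close> and \<open>l\<close> in the link of \<open>v\<close> that consists of bad pairs.  This graph is
  such a strong expander (second singular value at most \<open>sqrt (K l) \<lambda>\<close>) that the minority side, among
  those \<open>z\<close> that have few bad \<open>t\<close> containing \<open>v\<close>, is a factor \<open>l\<close> rarer than the bad pairs; this
  defines \<open>G v\<close>.  The remaining exceptional vertices, where bad pairs are much more frequent than on
  average, also cost only \<open>O(\<epsilon> / l)\<close>: the containment graph between vertices and faces of size \<open>L\<close>
  has squared second singular value at most \<open>1 / L + \<lambda>\<close>.  Markov's inequality at threshold \<open>1 / l\<close>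
  then loses only a constant.  The complement test reduces to the independent one because the
  complement walk in the link of \<open>t\<close> is an expander.\<close>

section \<open>Spectral gap of reversible walks\<close>

lemma upper_triangular_mult:
  fixes A B :: "real mat"
  assumes A: "A \<in> carrier_mat n n" and B: "B \<in> carrier_mat n n"
    and uA: "upper_triangular A" and uB: "upper_triangular B"
  shows "upper_triangular (A * B)" "i < n \<Longrightarrow> (A * B) $$ (i, i) = A $$ (i, i) * B $$ (i, i)"
proof -
  have e: "(A * B) $$ (i, j) = (\<Sum>l<n. A $$ (i, l) * B $$ (l, j))" if "i < n" "j < n" for i j
    using that A B by (auto simp: scalar_prod_def atLeast0LessThan intro!: sum.cong)
  have zA: "A $$ (i, j) = 0" if "j < i" "i < n" for i j
    using uA that A by (auto dest: upper_triangularD)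
  have zB: "B $$ (i, j) = 0" if "j < i" "i < n" for i j
    using uB that B by (auto dest: upper_triangularD)
  show "upper_triangular (A * B)"
  proof
    fix i j assume "j < i" "i < dim_row (A * B)"
    then have ij: "j < i" "i < n" using A by auto
    have "A $$ (i, l) * B $$ (l, j) = 0" if "l < n" for l
      using zA[of l i] zB[of j l] ij that by (cases "l < i") auto
    then have "(\<Sum>l<n. A $$ (i, l) * B $$ (l, j)) = 0" by (intro sum.neutral) blast
    then show "(A * B) $$ (i, j) = 0" using e[of i j] ij by simp
  qed
  show "(A * B) $$ (i, i) = A $$ (i, i) * B $$ (i, i)" if i: "i < n"
  proof -
    have "(\<Sum>l<n. A $$ (i, l) * B $$ (l, i)) = (\<Sum>l\<in>{i}. A $$ (i, l) * B $$ (l, i))"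
    proof (rule sum.mono_neutral_right)
      show "\<forall>l\<in>{..<n} - {i}. A $$ (i, l) * B $$ (l, i) = 0"
        using zA zB i by (metis DiffE insertI1 lessThan_iff linorder_neqE_nat mult_eq_0_iff)
    qed (use i in auto)
    then show ?thesis using e i by simp
  qed
qed

lemma upper_triangular_pow:
  fixes A :: "real mat"
  assumes A: "A \<in> carrier_mat n n" and u: "upper_triangular A"
  shows "upper_triangular (A ^\<^sub>m k) \<and> (\<forall>i<n. (A ^\<^sub>m k) $$ (i, i) = (A $$ (i, i)) ^ k)"
proof (induction k)
  case 0
  then show ?case using A by auto
next
  case (Suc k)
  then show ?case
    using upper_triangular_mult[OF pow_carrier_mat[OF A] A _ u] by auto
qed

lemma trace_mult_commute:
  fixes A B :: "real mat"
  assumes A: "A \<in> carrier_mat n n" and B: "B \<in> carrier_mat n n"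
  shows "(\<Sum>i<n. (A * B) $$ (i, i)) = (\<Sum>i<n. (B * A) $$ (i, i))"
proof -
  have "(\<Sum>i<n. (A * B) $$ (i, i)) = (\<Sum>i<n. \<Sum>j<n. A $$ (i, j) * B $$ (j, i))"
    using A B by (auto simp: scalar_prod_def atLeast0LessThan intro!: sum.cong)
  also have "\<dots> = (\<Sum>j<n. \<Sum>i<n. B $$ (j, i) * A $$ (i, j))"
    by (subst sum.swap) (simp add: mult.commute)
  also have "\<dots> = (\<Sum>i<n. (B * A) $$ (i, i))"
    using A B by (auto simp: scalar_prod_def atLeast0LessThan intro!: sum.cong)
  finally show ?thesis .
qed

text \<open>The characteristic polynomial splits over the reals, so Schur decomposition conjugates
  \<open>A\<close> to a real upper triangular matrix with diagonal \<open>es\<close>. Its powers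
  carry the powers of \<open>es\<close> on the diagonal, and conjugation preserves the
  trace.\<close>

lemma trace_pow_eq_sum_eigenvalues:
  fixes A :: "real mat"
  assumes A: "A \<in> carrier_mat n n" and cp: "char_poly A = (\<Prod>e\<leftarrow>es. [:- e, 1:])"
  shows "(\<Sum>i<n. (A ^\<^sub>m k) $$ (i, i)) = (\<Sum>e\<leftarrow>es. e ^ k)"
proof -
  obtain B P Q where schur: "schur_decomposition A es = (B, P, Q)"
    by (cases "schur_decomposition A es")
  from schur_decomposition[OF A cp schur]
  have sim: "similar_mat_wit A B P Q" and u: "upper_triangular B" and d: "diag_mat B = es"
    by auto
  from similar_mat_witD2[OF A sim] have QP: "Q * P = 1\<^sub>m n" and B: "B \<in> carrier_mat n n"
    and P: "P \<in> carrier_mat n n" and Q: "Q \<in> carrier_mat n n" by auto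
  have Bk: "B ^\<^sub>m k \<in> carrier_mat n n" using B by simp
  have "A ^\<^sub>m k = (P * B ^\<^sub>m k) * Q" using similar_mat_wit_pow_id[OF sim] .
  then have "(\<Sum>i<n. (A ^\<^sub>m k) $$ (i, i)) = (\<Sum>i<n. (Q * (P * B ^\<^sub>m k)) $$ (i, i))"
    using trace_mult_commute[OF mult_carrier_mat[OF P Bk] Q] by simp
  also have "Q * (P * B ^\<^sub>m k) = B ^\<^sub>m k"
    using assoc_mult_mat[OF Q P Bk] QP left_mult_one_mat[OF Bk] by metis
  also have "(\<Sum>i<n. (B ^\<^sub>m k) $$ (i, i)) = (\<Sum>i<n. (B $$ (i, i)) ^ k)"
    using upper_triangular_pow[OF B u] by simp
  also have "\<dots> = (\<Sum>e\<leftarrow>es. e ^ k)"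
    unfolding d[symmetric] diag_mat_def using B
    by (simp add: o_def interv_sum_list_conv_sum_set_nat atLeast0LessThan)
  finally show ?thesis .
qed

section \<open>Cauchy-Schwarz and contraction by repeated squaring\<close>

lemma weighted_Cauchy_Schwarz:
  fixes p f g :: "'b \<Rightarrow> real"
  assumes "\<And>i. i \<in> I \<Longrightarrow> 0 \<le> p i"
  shows "(\<Sum>i\<in>I. p i * (f i * g i))\<^sup>2 \<le> (\<Sum>i\<in>I. p i * (f i)\<^sup>2) * (\<Sum>i\<in>I. p i * (g i)\<^sup>2)"
proof -
  define a b c where "a = (\<Sum>i\<in>I. p i * (f i)\<^sup>2)" and "b = (\<Sum>i\<in>I. p i * (f i * g i))"
    and "c = (\<Sum>i\<in>I. p i * (g i)\<^sup>2)"
  have c0: "0 \<le> c" unfolding c_def using assms by (auto intro!: sum_nonneg)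
  have q: "0 \<le> x\<^sup>2 * a + 2 * x * y * b + y\<^sup>2 * c" for x y
  proof -
    have "0 \<le> (\<Sum>i\<in>I. p i * (x * f i + y * g i)\<^sup>2)"
      using assms by (auto intro!: sum_nonneg)
    also have "\<dots> = (\<Sum>i\<in>I. x\<^sup>2 * (p i * (f i)\<^sup>2) + 2 * x * y * (p i * (f i * g i))
        + y\<^sup>2 * (p i * (g i)\<^sup>2))"
      by (intro sum.cong) (auto simp: power2_eq_square algebra_simps)
    also have "\<dots> = x\<^sup>2 * a + 2 * x * y * b + y\<^sup>2 * c"
      by (simp add: a_def b_def c_def sum.distrib sum_distrib_left)
    finally show ?thesis .
  qed
  have "b\<^sup>2 \<le> a * c"
  proof (cases "c = 0")
    case True
    \<comment> \<open>With \<open>c = 0\<close> the quadratic form at this point equals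
      \<open>- 2 * b^2\<close>, which forces \<open>b = 0\<close>.\<close>
    from q[of b "- a / 2 - 1"] True
    have "0 \<le> a * b\<^sup>2 + 2 * b * (- a / 2 - 1) * b" by (simp add: algebra_simps)
    then show ?thesis using True by (simp add: power2_eq_square algebra_simps)
  next
    case False
    then have c: "c > 0" using c0 by simp
    have "0 \<le> c\<^sup>2 * a + 2 * c * (- b) * b + (- b)\<^sup>2 * c" by (rule q)
    also have "\<dots> = c * (a * c - b\<^sup>2)" by (simp add: power2_eq_square algebra_simps)
    finally show ?thesis using c by (simp add: zero_le_mult_iff)
  qed
  then show ?thesis unfolding a_def b_def c_def .
qed

text \<open>Repeated squaring gives \<open>a 0 ^ (2 ^ j) \<le> a j\<close>, hence
  \<open>(a 0 / r) ^ (2 ^ j) \<le> C\<close> for every \<open>j\<close>; a ratio above 1 would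
  outgrow any \<open>C\<close>.\<close>

lemma pow_double_tower_bound:
  fixes q r C :: real and a :: "nat \<Rightarrow> real"
  assumes "\<And>j. 0 \<le> a j" "\<And>j. (a j)\<^sup>2 \<le> a (Suc j)" "\<And>j. a j \<le> C * r ^ (2 ^ j)" "0 < r"
  shows "a 0 \<le> r"
proof (rule ccontr)
  assume "\<not> a 0 \<le> r"
  then have g: "a 0 / r > 1" using assms(4) by simp
  have p: "a 0 ^ (2 ^ j) \<le> a j" for j
  proof (induction j)
    case (Suc j)
    have "a 0 ^ 2 ^ Suc j = (a 0 ^ 2 ^ j)\<^sup>2" by (simp add: power_even_eq)
    also have "\<dots> \<le> (a j)\<^sup>2" using Suc assms(1)[of 0] by (intro power_mono) auto
    also have "\<dots> \<le> a (Suc j)" by (rule assms)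
    finally show ?case .
  qed simp
  obtain n where n: "C < (a 0 / r) ^ n" using real_arch_pow[OF g] by blast
  have "(a 0 / r) ^ n \<le> (a 0 / r) ^ 2 ^ n"
    using g by (intro power_increasing) (auto simp: less_imp_le)
  also have "\<dots> \<le> C"
    using order.trans[OF p[of n] assms(3)[of n]] assms(4)
    by (simp add: power_divide divide_le_eq)
  finally show False using n by simp
qed

text \<open>On functions \<open>f\<close> of mean zero, \<open>N (A\<^sup>m f) \<le> (trace A\<^sup>2\<^sup>m - 1) N f\<close> in the weighted norm, and the
  trace is controlled by the characteristic polynomial.  Self-adjointness of \<open>A\<close> gives
  \<open>(N (A\<^sup>m f))\<^sup>2 \<le> N f * N (A\<^sup>2\<^sup>m f)\<close>, so the loss of the trace bound disappears along \<open>m = 2\<^sup>j\<close>.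
  This avoids orthogonal diagonalisation.\<close>
lemma reversible_walk_contraction:
  fixes A :: "real mat" and p :: "nat \<Rightarrow> real"
  assumes A: "A \<in> carrier_mat n n"
    and p: "\<And>i. i < n \<Longrightarrow> 0 < p i" and p1: "(\<Sum>i<n. p i) = 1"
    and rev: "\<And>i j. i < n \<Longrightarrow> j < n \<Longrightarrow> p i * A $$ (i, j) = p j * A $$ (j, i)"
    and row: "\<And>i. i < n \<Longrightarrow> (\<Sum>j<n. A $$ (i, j)) = 1"
    and eigs: "nontop_eigs_bounded A lam" and lam: "0 < lam" "lam < 1"
    and f0: "(\<Sum>i<n. p i * f i) = 0"
  shows "(\<Sum>i<n. p i * (\<Sum>j<n. A $$ (i, j) * f j)\<^sup>2) \<le> lam\<^sup>2 * (\<Sum>i<n. p i * (f i)\<^sup>2)"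
proof -
  define P where "P m i j = (A ^\<^sub>m m) $$ (i, j)" for m i j
  have Am: "A ^\<^sub>m m \<in> carrier_mat n n" for m using A by simp
  have P0: "P 0 i j = (if i = j then 1 else 0)" if "i < n" "j < n" for i j
    using that A by (simp add: P_def)
  have PS: "P (Suc m) i j = (\<Sum>l<n. P m i l * A $$ (l, j))" if "i < n" "j < n" for m i j
    using that A Am[of m] by (auto simp: P_def scalar_prod_def atLeast0LessThan intro!: sum.cong)
  have Padd: "P (m + k) i j = (\<Sum>l<n. P m i l * P k l j)" if "i < n" "j < n" for m k i j
    using that
  proof (induction k arbitrary: j)
    case 0
    then show ?case by (simp add: P0 if_distrib sum.delta cong: if_cong)
  next
    case (Suc k)
    have "P (m + Suc k) i j = (\<Sum>l<n. (\<Sum>h<n. P m i h * P k h l) * A $$ (l, j))"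
      using Suc PS by simp
    also have "\<dots> = (\<Sum>h<n. P m i h * (\<Sum>l<n. P k h l * A $$ (l, j)))"
      by (simp add: sum_distrib_left sum_distrib_right mult.assoc) (rule sum.swap)
    also have "\<dots> = (\<Sum>h<n. P m i h * P (Suc k) h j)" using Suc PS by simp
    finally show ?case .
  qed
  have P1: "P 1 i j = A $$ (i, j)" if "i < n" "j < n" for i j
    using that A by (simp add: P_def)
  have Prev: "p i * P m i j = p j * P m j i" if "i < n" "j < n" for m i j
    using that
  proof (induction m arbitrary: i j)
    case 0
    then show ?case by (simp add: P0)
  next
    case (Suc m)
    have "p i * P (Suc m) i j = (\<Sum>l<n. (p i * P m i l) * A $$ (l, j))"
      using Suc.prems PS by (simp add: sum_distrib_left mult.assoc)
    also have "\<dots> = (\<Sum>l<n. (p l * A $$ (l, j)) * P m l i)"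
    proof (intro sum.cong refl)
      fix l assume "l \<in> {..<n}"
      then have e: "p i * P m i l = p l * P m l i" using Suc by simp
      show "(p i * P m i l) * A $$ (l, j) = (p l * A $$ (l, j)) * P m l i"
        unfolding e by (simp add: mult_ac)
    qed
    also have "\<dots> = (\<Sum>l<n. (p j * A $$ (j, l)) * P m l i)"
      using Suc rev by (intro sum.cong) auto
    also have "\<dots> = p j * P (1 + m) j i"
      unfolding Padd[OF Suc.prems(2,1)] using Suc.prems P1
      by (simp add: sum_distrib_left mult.assoc)
    finally show ?case by simp
  qed
  have Prow: "(\<Sum>j<n. P m i j) = 1" if "i < n" for m i
    using that
  proof (induction m)
    case 0
    then show ?case by (simp add: P0)
  next
    case (Suc m)
    have "(\<Sum>j<n. P (Suc m) i j) = (\<Sum>l<n. P m i l * (\<Sum>j<n. A $$ (l, j)))"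
      using Suc PS by (simp add: sum_distrib_left) (rule sum.swap)
    then show ?case using Suc row by simp
  qed
  obtain e0 es where cp: "char_poly A = [:- e0, 1:] * (\<Prod>e\<leftarrow>es. [:- e, 1:])"
    and es: "\<And>e. e \<in> set es \<Longrightarrow> e \<le> e0 \<and> - lam \<le> e \<and> e \<le> lam"
    using eigs unfolding nontop_eigs_bounded_def by auto
  have n0: "n > 0" using p1 by (cases n) auto
  \<comment> \<open>The row sums make the constant vector an eigenvector for 1. The roots in
    \<open>es\<close> are at most \<open>lam < 1\<close>, so the distinguished root
    \<open>e0\<close> must be this 1.\<close>
  have "eigenvector A (vec n (\<lambda>_. 1)) 1"
  proof -
    have "vec n (\<lambda>_. 1::real) $ 0 \<noteq> 0\<^sub>v n $ 0" using n0 by simp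
    then have "vec n (\<lambda>_. 1::real) \<noteq> 0\<^sub>v n" by metis
    moreover have "A *\<^sub>v vec n (\<lambda>_. 1) = 1 \<cdot>\<^sub>v vec n (\<lambda>_. 1)"
      using A row by (intro eq_vecI) (auto simp: scalar_prod_def atLeast0LessThan)
    ultimately show ?thesis using A unfolding eigenvector_def by auto
  qed
  then have "poly (char_poly A) 1 = 0"
    using eigenvalue_root_char_poly[OF A] unfolding eigenvalue_def by blast
  then have "e0 = 1 \<or> 1 \<in> set es"
    unfolding cp by (auto simp: poly_prod_list prod_list_zero_iff)
  then have e0: "e0 = 1" using es lam by force
  have tr: "(\<Sum>i<n. P k i i) = 1 + (\<Sum>e\<leftarrow>es. e ^ k)" for k
    using trace_pow_eq_sum_eigenvalues[OF A, of "e0 # es" k] cp e0 by (simp add: P_def)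
  have tr2: "(\<Sum>i<n. P (m + m) i i) - 1 \<le> real (length es) * (lam\<^sup>2) ^ m" for m
  proof -
    have "e ^ (m + m) \<le> (lam\<^sup>2) ^ m" if "e \<in> set es" for e
    proof -
      have "\<bar>e\<bar> \<le> lam" using es[OF that] by auto
      then have "e\<^sup>2 \<le> lam\<^sup>2" by (rule abs_le_square_iff[THEN iffD1, OF order.trans[OF _ abs_ge_self]])
      then have "(e\<^sup>2) ^ m \<le> (lam\<^sup>2) ^ m" by (rule power_mono) simp
      then show ?thesis by (metis mult_2 power_mult)
    qed
    then have "(\<Sum>e\<leftarrow>es. e ^ (m + m)) \<le> (\<Sum>e\<leftarrow>es. (lam\<^sup>2) ^ m)"
      by (intro sum_list_mono)
    then show ?thesis unfolding tr by (simp add: sum_list_triv)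
  qed
  define N where "N g = (\<Sum>i<n. p i * (g i)\<^sup>2)" for g :: "nat \<Rightarrow> real"
  define T where "T m i = (\<Sum>j<n. P m i j * f j)" for m i
  have N0: "0 \<le> N g" for g unfolding N_def using p by (auto intro!: sum_nonneg simp: less_imp_le)
  have Tb: "N (T m) \<le> N f * ((\<Sum>i<n. P (m + m) i i) - 1)" for m
  proof -
    have "(T m i)\<^sup>2 \<le> (\<Sum>j<n. p j * (P m i j / p j - 1)\<^sup>2) * N f" if i: "i < n" for i
    proof -
      \<comment> \<open>Since \<open>f\<close> has mean zero, the kernel may be shifted by the
        stationary distribution \<open>p\<close>; this is what subtracts 1 from the trace.\<close>
      have "T m i = (\<Sum>j<n. P m i j * f j) - (\<Sum>j<n. p j * f j)" unfolding T_def f0 by simp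
      also have "\<dots> = (\<Sum>j<n. p j * ((P m i j / p j - 1) * f j))"
        unfolding sum_subtractf[symmetric]
        using p by (intro sum.cong) (auto simp: field_simps dest!: less_imp_neq[OF p])
      finally show ?thesis unfolding N_def
        using weighted_Cauchy_Schwarz[of "{..<n}" p "\<lambda>j. P m i j / p j - 1" f] p
        by (simp add: less_imp_le)
    qed
    then have "N (T m) \<le> (\<Sum>i<n. p i * ((\<Sum>j<n. p j * (P m i j / p j - 1)\<^sup>2) * N f))"
      unfolding N_def using p by (intro sum_mono mult_left_mono) (auto simp: less_imp_le)
    also have "\<dots> = N f * (\<Sum>i<n. p i * (\<Sum>j<n. p j * (P m i j / p j - 1)\<^sup>2))"
      by (simp add: sum_distrib_left algebra_simps)
    \<comment> \<open>Reversibility turns \<open>p i * (P m i j)^2 / p j\<close> into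
      \<open>P m i j * P m j i\<close>, whose double sum is the trace of the power
      \<open>m + m\<close>. The cross terms and the constant terms contribute -2 and 1.\<close>
    also have "(\<Sum>i<n. p i * (\<Sum>j<n. p j * (P m i j / p j - 1)\<^sup>2))
        = (\<Sum>i<n. (\<Sum>j<n. P m i j * P m j i) - 2 * p i * (\<Sum>j<n. P m i j) + p i * (\<Sum>j<n. p j))"
    proof (intro sum.cong refl)
      fix i assume i: "i \<in> {..<n}"
      have "p i * (p j * (P m i j / p j - 1)\<^sup>2)
          = P m i j * P m j i - 2 * p i * P m i j + p i * p j" if j: "j < n" for j
      proof -
        have pj: "p j \<noteq> 0" using p[OF j] by simp
        have "P m j i = p i * P m i j / p j" using Prev[of i j m] i j pj by (simp add: field_simps)
        then show ?thesis using pj by (simp add: field_simps power2_eq_square)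
      qed
      then show "p i * (\<Sum>j<n. p j * (P m i j / p j - 1)\<^sup>2)
          = (\<Sum>j<n. P m i j * P m j i) - 2 * p i * (\<Sum>j<n. P m i j) + p i * (\<Sum>j<n. p j)"
        by (simp add: sum_distrib_left sum.distrib sum_subtractf)
    qed
    also have "\<dots> = (\<Sum>i<n. P (m + m) i i - p i)"
      using Prow p1 Padd by (intro sum.cong) auto
    also have "\<dots> = (\<Sum>i<n. P (m + m) i i) - 1" by (simp add: sum_subtractf p1)
    finally show ?thesis .
  qed
  have Tsq: "(N (T m))\<^sup>2 \<le> N f * N (T (m + m))" for m
  proof -
    have "N (T m) = (\<Sum>i<n. \<Sum>j<n. (p i * P m i j) * (f j * T m i))"
      unfolding N_def power2_eq_square
      by (subst (1) T_def) (simp add: sum_distrib_left sum_distrib_right mult.assoc)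
    also have "\<dots> = (\<Sum>j<n. \<Sum>i<n. (p j * P m j i) * (f j * T m i))"
      by (subst sum.swap) (intro sum.cong refl, use Prev in auto)
    also have "\<dots> = (\<Sum>j<n. p j * (f j * (\<Sum>i<n. P m j i * T m i)))"
      by (simp add: sum_distrib_left algebra_simps)
    also have "\<dots> = (\<Sum>j<n. p j * (f j * T (m + m) j))"
    proof (intro sum.cong refl)
      fix j assume "j \<in> {..<n}"
      then have "(\<Sum>i<n. P m j i * T m i) = T (m + m) j"
        unfolding T_def by (simp add: Padd sum_distrib_left sum_distrib_right mult.assoc)
          (rule sum.swap)
      then show "p j * (f j * (\<Sum>i<n. P m j i * T m i)) = p j * (f j * T (m + m) j)" by simp
    qed
    finally show ?thesis
      unfolding N_def using weighted_Cauchy_Schwarz[of "{..<n}" p f "T (m + m)"] p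
      by (simp add: less_imp_le)
  qed
  have T1: "(\<Sum>i<n. p i * (\<Sum>j<n. A $$ (i, j) * f j)\<^sup>2) = N (T 1)"
    unfolding N_def T_def using P1 by simp
  show ?thesis
  proof (cases "N f = 0")
    case True
    then have "N (T 1) = 0" using Tb[of 1] N0[of "T 1"] by simp
    then show ?thesis unfolding T1 using N0[of f] by (simp add: N_def)
  next
    case False
    then have Nf: "N f > 0" using N0[of f] by simp
    have "N (T (2 ^ 0)) / N f \<le> lam\<^sup>2"
    \<comment> \<open>The trace bound loses only the number of non-top eigenvalues, and the doubling
      removes this constant.\<close>
    proof (rule pow_double_tower_bound[where C = "real (length es)"])
      fix j :: nat
      show "0 \<le> N (T (2 ^ j)) / N f" using N0 by simp
      have "(N (T (2 ^ j)))\<^sup>2 \<le> N f * N (T (2 ^ Suc j))" using Tsq[of "2 ^ j"] by (simp add: mult_2)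
      then show "(N (T (2 ^ j)) / N f)\<^sup>2 \<le> N (T (2 ^ Suc j)) / N f"
        using Nf by (simp add: power_divide field_simps power2_eq_square)
      have "N (T (2 ^ j)) \<le> N f * (real (length es) * (lam\<^sup>2) ^ (2 ^ j))"
        using order.trans[OF Tb[of "2 ^ j"] mult_left_mono[OF tr2[of "2 ^ j"] N0[of f]]] .
      then show "N (T (2 ^ j)) / N f \<le> real (length es) * (lam\<^sup>2) ^ (2 ^ j)"
        using Nf by (simp add: field_simps)
    qed (use lam in simp)
    then show ?thesis unfolding T1 using Nf by (simp add: N_def[of f, symmetric] divide_le_eq)
  qed
qed

section \<open>Averages over links\<close>

locale weighted_complex =
  fixes w :: "'v set \<Rightarrow> real" and d :: nat
  assumes wc: "wcomplex w d"
begin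

definition V :: "'v set" where "V = \<Union>(supp w)"

text \<open>This is \<open>fprob\<close> without its binomial factor; it is positive exactly on the
  faces.\<close>

definition wt :: "'v set \<Rightarrow> real" where "wt s = sum w {a \<in> supp w. s \<subseteq> a}"

text \<open>Sets that are not faces of the link stay in the index set: \<open>pr\<close> gives them
  weight 0, so reindexing needs no restriction to faces.\<close>

definition lk :: "'v set \<Rightarrow> nat \<Rightarrow> 'v set set" where
  "lk s j = {u. u \<subseteq> V \<and> card u = j \<and> u \<inter> s = {}}"

definition pr :: "'v set \<Rightarrow> nat \<Rightarrow> 'v set \<Rightarrow> real" where
  "pr s j u = wt (s \<union> u) / (wt s * real ((Suc d - card s) choose j))"

text \<open>\<open>avg s j F\<close> is the expectation of \<open>F\<close> over the faces with \<open>j\<close> vertices (not of dimension \<open>j\<close>) of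
  the link of \<open>s\<close>; it is \<open>0\<close> if \<open>s\<close> is not a face.\<close>
definition avg :: "'v set \<Rightarrow> nat \<Rightarrow> ('v set \<Rightarrow> real) \<Rightarrow> real" where
  "avg s j F = (\<Sum>u\<in>lk s j. pr s j u * F u)"

lemma w_nonneg: "0 \<le> w a" and finite_supp: "finite (supp w)" and sum_supp: "sum w (supp w) = 1"
  and supp_face: "a \<in> supp w \<Longrightarrow> finite a \<and> card a = Suc d"
  using wc unfolding wcomplex_def by blast+

lemma finite_V [simp]: "finite V"
  unfolding V_def using finite_supp supp_face by (intro finite_Union) blast+

lemma finite_lk [simp]: "finite (lk s j)"
  by (rule finite_subset[of _ "Pow V"]) (auto simp: lk_def)

lemma lk_finite: "u \<in> lk s j \<Longrightarrow> finite u"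
  unfolding lk_def by (auto intro: finite_subset[OF _ finite_V])

lemma lkD: "u \<in> lk s j \<Longrightarrow> finite u \<and> u \<subseteq> V \<and> card u = j \<and> u \<inter> s = {} \<and> s \<inter> u = {}"
  using lk_finite[of u s j] by (auto simp: lk_def)

lemma wt_nonneg: "0 \<le> wt s"
  unfolding wt_def using w_nonneg by (intro sum_nonneg) blast

lemma wt_antimono: "s \<subseteq> t \<Longrightarrow> wt t \<le> wt s"
  unfolding wt_def using finite_supp w_nonneg by (intro sum_mono2) auto

lemma wt_zero_mono: "wt s = 0 \<Longrightarrow> s \<subseteq> t \<Longrightarrow> wt t = 0"
  using wt_antimono[of s t] wt_nonneg[of t] by simp

lemma wt_pos_mono: "0 < wt t \<Longrightarrow> s \<subseteq> t \<Longrightarrow> 0 < wt s"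
  using wt_antimono[of s t] by simp

lemma wt_pos_iff: "0 < wt s \<longleftrightarrow> s \<in> faces w"
proof
  assume "0 < wt s"
  then have "{a \<in> supp w. s \<subseteq> a} \<noteq> {}" unfolding wt_def by (metis less_irrefl sum.empty)
  then show "s \<in> faces w" unfolding faces_def by auto
next
  assume "s \<in> faces w"
  then obtain a where a: "a \<in> supp w" "s \<subseteq> a" unfolding faces_def by auto
  have "w a > 0" using a(1) w_nonneg[of a] unfolding supp_def by (simp add: order_less_le)
  moreover have "w a \<le> wt s" unfolding wt_def
    using a finite_supp w_nonneg by (intro member_le_sum) auto
  ultimately show "0 < wt s" by simp
qed

lemma wt_empty: "wt {} = 1"
  unfolding wt_def using sum_supp by simp

lemma wt_posD:
  assumes "0 < wt s"
  shows "finite s" "s \<subseteq> V" "card s \<le> Suc d"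
proof -
  from assms obtain a where a: "a \<in> supp w" "s \<subseteq> a" unfolding wt_pos_iff faces_def by auto
  then have fa: "finite a" "card a = Suc d" "a \<subseteq> V" using supp_face V_def by auto
  show "finite s" using finite_subset[OF a(2) fa(1)] .
  show "s \<subseteq> V" using a(2) fa(3) by blast
  show "card s \<le> Suc d" using card_mono[OF fa(1) a(2)] fa(2) by simp
qed

lemma pr_nonneg: "0 \<le> pr s j u"
  unfolding pr_def using wt_nonneg by simp

text \<open>Double counting of pairs of \<open>u\<close> and a top face: a top face containing
  \<open>s\<close> has \<open>Suc d - card s\<close> further vertices, of which \<open>u\<close>
  takes \<open>j\<close>.\<close>

lemma sum_wt_lk:
  assumes "finite s"
  shows "(\<Sum>u\<in>lk s j. wt (s \<union> u)) = real ((Suc d - card s) choose j) * wt s"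
proof -
  have "(\<Sum>u\<in>lk s j. wt (s \<union> u)) = (\<Sum>u\<in>lk s j. \<Sum>a\<in>supp w. if s \<union> u \<subseteq> a then w a else 0)"
    unfolding wt_def using finite_supp by (simp add: sum.inter_filter)
  also have "\<dots> = (\<Sum>a\<in>supp w. \<Sum>u\<in>lk s j. if s \<union> u \<subseteq> a then w a else 0)"
    by (rule sum.swap)
  also have "\<dots> = (\<Sum>a\<in>supp w. if s \<subseteq> a then real ((Suc d - card s) choose j) * w a else 0)"
  proof (intro sum.cong refl)
    fix a assume a: "a \<in> supp w"
    then have fa: "finite a" "card a = Suc d" and aV: "a \<subseteq> V" using supp_face V_def by auto
    show "(\<Sum>u\<in>lk s j. if s \<union> u \<subseteq> a then w a else 0)
        = (if s \<subseteq> a then real ((Suc d - card s) choose j) * w a else 0)"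
    proof (cases "s \<subseteq> a")
      case True
      have "(\<Sum>u\<in>lk s j. if s \<union> u \<subseteq> a then w a else 0) = real (card {u \<in> lk s j. s \<union> u \<subseteq> a}) * w a"
        by (simp add: sum.inter_filter[symmetric])
      also have "{u \<in> lk s j. s \<union> u \<subseteq> a} = {u. u \<subseteq> a - s \<and> card u = j}"
        using True aV unfolding lk_def by auto
      also have "card \<dots> = (Suc d - card s) choose j"
        using n_subsets[of "a - s" j] fa True assms by (simp add: card_Diff_subset)
      finally show ?thesis using True by simp
    qed (auto intro!: sum.neutral)
  qed
  also have "\<dots> = real ((Suc d - card s) choose j) * wt s"
    unfolding wt_def sum_distrib_left using finite_supp by (simp add: sum.inter_filter)
  finally show ?thesis .
qed

section \<open>Calculus of expectations over links\<close>

lemma avg_cong: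
  assumes "\<And>u. u \<in> lk s j \<Longrightarrow> 0 < wt (s \<union> u) \<Longrightarrow> F u = G u"
  shows "avg s j F = avg s j G"
  unfolding avg_def
proof (intro sum.cong refl)
  fix u assume u: "u \<in> lk s j"
  show "pr s j u * F u = pr s j u * G u"
    using assms[OF u] wt_nonneg[of "s \<union> u"] by (cases "wt (s \<union> u) = 0") (auto simp: pr_def)
qed

lemma avg_mono:
  assumes "\<And>u. u \<in> lk s j \<Longrightarrow> 0 < wt (s \<union> u) \<Longrightarrow> F u \<le> G u"
  shows "avg s j F \<le> avg s j G"
  unfolding avg_def
proof (intro sum_mono)
  fix u assume u: "u \<in> lk s j"
  show "pr s j u * F u \<le> pr s j u * G u"
  proof (cases "wt (s \<union> u) = 0")
    case False
    then have "F u \<le> G u" using assms[OF u] wt_nonneg[of "s \<union> u"] by simp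
    then show ?thesis using pr_nonneg by (rule mult_left_mono)
  qed (simp add: pr_def)
qed

lemma avg_add: "avg s j (\<lambda>u. F u + G u) = avg s j F + avg s j G"
  unfolding avg_def by (simp add: algebra_simps sum.distrib)

lemma avg_diff: "avg s j (\<lambda>u. F u - G u) = avg s j F - avg s j G"
  unfolding avg_def by (simp add: algebra_simps sum_subtractf)

lemma avg_cmult: "avg s j (\<lambda>u. c * F u) = c * avg s j F"
  unfolding avg_def by (simp add: sum_distrib_left algebra_simps)

lemma avg_cmult_right: "avg s j (\<lambda>u. F u * c) = avg s j F * c"
  using avg_cmult[of s j c F] by (simp add: mult.commute)

lemma avg_sum: "avg s j (\<lambda>u. \<Sum>i\<in>I. F i u) = (\<Sum>i\<in>I. avg s j (F i))"
  unfolding avg_def by (simp add: sum_distrib_left) (rule sum.swap)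

lemma avg_zero [simp]: "avg s j (\<lambda>u. 0) = 0"
  unfolding avg_def by simp

lemma avg_nonneg: "(\<And>u. u \<in> lk s j \<Longrightarrow> 0 < wt (s \<union> u) \<Longrightarrow> 0 \<le> F u) \<Longrightarrow> 0 \<le> avg s j F"
  using avg_mono[of s j "\<lambda>_. 0" F] by simp

lemma avg_const:
  assumes "0 < wt s" "card s + j \<le> Suc d"
  shows "avg s j (\<lambda>_. c) = c"
proof -
  have "(Suc d - card s) choose j > 0" using assms by (simp add: zero_less_binomial)
  then have "(\<Sum>u\<in>lk s j. pr s j u) = 1"
    unfolding pr_def sum_divide_distrib[symmetric] sum_wt_lk[OF wt_posD(1)[OF assms(1)]]
    using assms(1) by (simp add: mult.commute)
  then show ?thesis unfolding avg_def by (simp add: sum_distrib_right[symmetric])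
qed

lemma avg_Cauchy_Schwarz:
  "(avg s j (\<lambda>u. F u * G u))\<^sup>2 \<le> avg s j (\<lambda>u. (F u)\<^sup>2) * avg s j (\<lambda>u. (G u)\<^sup>2)"
  unfolding avg_def using weighted_Cauchy_Schwarz[of "lk s j" "pr s j" F G] pr_nonneg by blast

lemma avg_square_le:
  assumes "0 < wt s" "card s + j \<le> Suc d"
  shows "(avg s j F)\<^sup>2 \<le> avg s j (\<lambda>u. (F u)\<^sup>2)"
  using avg_Cauchy_Schwarz[of s j F "\<lambda>_. 1"] avg_const[OF assms, of 1] by simp

lemma avg_le_const:
  assumes "0 < wt s" "card s + j \<le> Suc d" "\<And>u. u \<in> lk s j \<Longrightarrow> 0 < wt (s \<union> u) \<Longrightarrow> F u \<le> c"
  shows "avg s j F \<le> c"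
  using avg_mono[of s j F "\<lambda>_. c"] avg_const[OF assms(1,2)] assms(3) by simp

lemma avg_diff_const_square:
  assumes "0 < wt s" "card s + j \<le> Suc d"
  shows "avg s j (\<lambda>u. (F u - c)\<^sup>2) = avg s j (\<lambda>u. (F u)\<^sup>2) - 2 * c * avg s j F + c\<^sup>2"
proof -
  have "avg s j (\<lambda>u. (F u - c)\<^sup>2) = avg s j (\<lambda>u. ((F u)\<^sup>2 - (2 * c) * F u) + c\<^sup>2)"
    by (intro avg_cong) (simp add: power2_diff)
  then show ?thesis
    unfolding avg_add avg_diff avg_cmult avg_const[OF assms] by simp
qed

text \<open>Drawing an \<open>(i + j)\<close>-set and marking an \<open>i\<close>-subset has the
  same law as drawing the \<open>i\<close>-set first and the rest in its link. The swap, split and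
  tower rules below and the partition in the complement walk all rest on this.\<close>

lemma avg_marked:
  assumes s: "finite s"
  shows "avg s (i + j) (\<lambda>t. \<Sum>x\<in>{x. x \<subseteq> t \<and> card x = i}. F x (t - x))
    = real ((i + j) choose i) * avg s i (\<lambda>x. avg (s \<union> x) j (F x))"
proof -
  define N where "N = Suc d - card s"
  have lhs: "avg s (i + j) (\<lambda>t. \<Sum>x\<in>{x. x \<subseteq> t \<and> card x = i}. F x (t - x))
      = (\<Sum>t\<in>lk s (i + j). \<Sum>x\<in>{x. x \<subseteq> t \<and> card x = i}. wt (s \<union> t) * F x (t - x))
        / (wt s * real (N choose (i + j)))"
    unfolding avg_def pr_def N_def by (simp add: sum_divide_distrib sum_distrib_left mult_ac)
  have "(\<Sum>t\<in>lk s (i + j). \<Sum>x\<in>{x. x \<subseteq> t \<and> card x = i}. wt (s \<union> t) * F x (t - x))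
      = (\<Sum>(t, x)\<in>Sigma (lk s (i + j)) (\<lambda>t. {x. x \<subseteq> t \<and> card x = i}). wt (s \<union> t) * F x (t - x))"
    by (rule sum.Sigma) (auto dest: lk_finite)
  also have "\<dots> = (\<Sum>(x, y)\<in>Sigma (lk s i) (\<lambda>x. lk (s \<union> x) j). wt (s \<union> x \<union> y) * F x y)"
  proof (rule sum.reindex_bij_witness[where j = "\<lambda>(t, x). (x, t - x)" and i = "\<lambda>(x, y). (x \<union> y, x)"])
    fix p assume p: "p \<in> Sigma (lk s (i + j)) (\<lambda>t. {x. x \<subseteq> t \<and> card x = i})"
    then obtain t x where tx: "p = (t, x)" "t \<in> lk s (i + j)" "x \<subseteq> t" "card x = i" by auto
    have ft: "finite t" "finite x" using lk_finite[OF tx(2)] finite_subset[OF tx(3)] by auto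
    show "(case case p of (t, x) \<Rightarrow> (x, t - x) of (x, y) \<Rightarrow> (x \<union> y, x)) = p"
      using tx by auto
    show "(case p of (t, x) \<Rightarrow> (x, t - x)) \<in> Sigma (lk s i) (\<lambda>x. lk (s \<union> x) j)"
      using tx ft by (auto simp: lk_def card_Diff_subset)
    have "s \<union> x \<union> (t - x) = s \<union> t" using tx by auto
    then show "(case case p of (t, x) \<Rightarrow> (x, t - x) of (x, y) \<Rightarrow> wt (s \<union> x \<union> y) * F x y)
        = (case p of (t, x) \<Rightarrow> wt (s \<union> t) * F x (t - x))" using tx by simp
  next
    fix q assume "q \<in> Sigma (lk s i) (\<lambda>x. lk (s \<union> x) j)"
    then obtain x y where xy: "q = (x, y)" "x \<in> lk s i" "y \<in> lk (s \<union> x) j" by auto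
    have f: "finite x" "finite y" using lk_finite[OF xy(2)] lk_finite[OF xy(3)] by auto
    have dis: "x \<inter> y = {}" using xy by (auto simp: lk_def)
    show "(case case q of (x, y) \<Rightarrow> (x \<union> y, x) of (t, x) \<Rightarrow> (x, t - x)) = q"
      using xy dis by auto
    show "(case q of (x, y) \<Rightarrow> (x \<union> y, x)) \<in> Sigma (lk s (i + j)) (\<lambda>t. {x. x \<subseteq> t \<and> card x = i})"
      using xy f dis by (auto simp: lk_def card_Un_disjoint)
  qed
  also have "\<dots> = (\<Sum>x\<in>lk s i. \<Sum>y\<in>lk (s \<union> x) j. wt (s \<union> x \<union> y) * F x y)"
    by (rule sum.Sigma[symmetric]) auto
  finally have eq: "avg s (i + j) (\<lambda>t. \<Sum>x\<in>{x. x \<subseteq> t \<and> card x = i}. F x (t - x))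
      = (\<Sum>x\<in>lk s i. \<Sum>y\<in>lk (s \<union> x) j. wt (s \<union> x \<union> y) * F x y) / (wt s * real (N choose (i + j)))"
    unfolding lhs by simp
  have rhs: "avg s i (\<lambda>x. avg (s \<union> x) j (F x))
      = (\<Sum>x\<in>lk s i. \<Sum>y\<in>lk (s \<union> x) j. wt (s \<union> x \<union> y) * F x y)
        / (wt s * (real (N choose i) * real ((N - i) choose j)))"
    unfolding avg_def sum_divide_distrib
  proof (intro sum.cong refl)
    fix x assume x: "x \<in> lk s i"
    have c: "Suc d - card (s \<union> x) = N - i"
      using lkD[OF x] s by (simp add: card_Un_disjoint N_def)
    show "pr s i x * (\<Sum>u\<in>lk (s \<union> x) j. pr (s \<union> x) j u * F x u)
      = (\<Sum>y\<in>lk (s \<union> x) j. wt (s \<union> x \<union> y) * F x y / (wt s * (real (N choose i) * real ((N - i) choose j))))"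
      unfolding sum_distrib_left
    proof (intro sum.cong refl)
      fix y
      show "pr s i x * (pr (s \<union> x) j y * F x y)
        = wt (s \<union> x \<union> y) * F x y / (wt s * (real (N choose i) * real ((N - i) choose j)))"
      \<comment> \<open>When \<open>s \<union> x\<close> is not a face, division by zero makes the
        inner measure 0, and all larger sets have weight 0 too.\<close>
      proof (cases "wt (s \<union> x) = 0")
        case True
        then have "wt (s \<union> x \<union> y) = 0" by (rule wt_zero_mono) auto
        then show ?thesis by (simp add: pr_def)
      next
        case False
        then show ?thesis unfolding pr_def c N_def[symmetric] by (simp add: field_simps)
      qed
    qed
  qed
  \<comment> \<open>Both products count pairs of disjoint sets of sizes \<open>i\<close> and
    \<open>j\<close> among \<open>N\<close> points; for \<open>i + j > N\<close> both
    vanish.\<close>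
  have b: "(N choose (i + j)) * ((i + j) choose i) = (N choose i) * ((N - i) choose j)"
  proof (cases "i + j \<le> N")
    case True
    then show ?thesis using choose_mult[of i "i + j" N] by simp
  next
    case False
    then show ?thesis by (cases "i \<le> N") (auto simp: binomial_eq_0)
  qed
  have b': "real (N choose (i + j)) * real ((i + j) choose i) = real (N choose i) * real ((N - i) choose j)"
    using b by (metis of_nat_mult)
  have "(i + j) choose i > 0" by simp
  then show ?thesis unfolding eq rhs b'[symmetric] by simp
qed

text \<open>Both orders arise from one \<open>(i + j)\<close>-set \<open>t\<close>; complementation
  in \<open>t\<close> exchanges which of the two parts is marked.\<close>

lemma avg_swap:
  assumes s: "finite s"
  shows "avg s i (\<lambda>x. avg (s \<union> x) j (F x)) = avg s j (\<lambda>y. avg (s \<union> y) i (\<lambda>x. F x y))"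
proof -
  have "real ((i + j) choose i) * avg s i (\<lambda>x. avg (s \<union> x) j (F x))
      = avg s (i + j) (\<lambda>t. \<Sum>x\<in>{x. x \<subseteq> t \<and> card x = i}. F x (t - x))"
    using avg_marked[OF s, of i j F] by simp
  also have "\<dots> = avg s (j + i) (\<lambda>t. \<Sum>y\<in>{y. y \<subseteq> t \<and> card y = j}. F (t - y) y)"
    unfolding add.commute[of j i]
  proof (rule avg_cong)
    fix t assume "t \<in> lk s (i + j)"
    then have t: "finite t" "card t = i + j" using lkD[of t s "i + j"] by auto
    show "(\<Sum>x\<in>{x. x \<subseteq> t \<and> card x = i}. F x (t - x)) = (\<Sum>y\<in>{y. y \<subseteq> t \<and> card y = j}. F (t - y) y)"
    proof (rule sum.reindex_bij_witness[where i = "\<lambda>y. t - y" and j = "\<lambda>x. t - x"])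
      fix x assume x: "x \<in> {x. x \<subseteq> t \<and> card x = i}"
      then have "finite x" using finite_subset[OF _ t(1)] by blast
      with x show "t - x \<in> {y. y \<subseteq> t \<and> card y = j}" "t - (t - x) = x"
        "F (t - (t - x)) (t - x) = F x (t - x)"
        using t by (auto simp: card_Diff_subset double_diff)
    next
      fix x assume x: "x \<in> {x. x \<subseteq> t \<and> card x = j}"
      then have "finite x" using finite_subset[OF _ t(1)] by blast
      with x show "t - x \<in> {y. y \<subseteq> t \<and> card y = i}" "t - (t - x) = x"
        using t by (auto simp: card_Diff_subset double_diff)
    qed
  qed
  also have "\<dots> = real ((j + i) choose j) * avg s j (\<lambda>y. avg (s \<union> y) i (\<lambda>x. F x y))"
    by (rule avg_marked[OF s, of j i "\<lambda>y x. F x y"])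
  also have "(j + i) choose j = (i + j) choose i"
    using binomial_symmetric[of i "i + j"] by (simp add: add.commute)
  finally show ?thesis by simp
qed

lemma avg_split:
  assumes s: "finite s"
  shows "avg s (i + j) F = avg s i (\<lambda>x. avg (s \<union> x) j (\<lambda>y. F (x \<union> y)))"
proof -
  have "real ((i + j) choose i) * avg s i (\<lambda>x. avg (s \<union> x) j (\<lambda>y. F (x \<union> y)))
      = avg s (i + j) (\<lambda>t. \<Sum>x\<in>{x. x \<subseteq> t \<and> card x = i}. F (x \<union> (t - x)))"
    using avg_marked[OF s, of i j "\<lambda>x y. F (x \<union> y)"] by simp
  also have "\<dots> = avg s (i + j) (\<lambda>t. real ((i + j) choose i) * F t)"
  proof (rule avg_cong)
    fix t assume "t \<in> lk s (i + j)"
    then have t: "finite t" "card t = i + j" using lkD[of t s "i + j"] by auto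
    have "(\<Sum>x\<in>{x. x \<subseteq> t \<and> card x = i}. F (x \<union> (t - x))) = (\<Sum>x\<in>{x. x \<subseteq> t \<and> card x = i}. F t)"
      by (intro sum.cong refl) (auto intro!: arg_cong[where f = F])
    then show "(\<Sum>x\<in>{x. x \<subseteq> t \<and> card x = i}. F (x \<union> (t - x))) = real ((i + j) choose i) * F t"
      using n_subsets[OF t(1), of i] t by simp
  qed
  finally show ?thesis by (simp add: avg_cmult)
qed

text \<open>A random link carries, on average, the original measure: after the swap the inner
  average is that of a constant. The size condition keeps that inner average from being
  empty.\<close>

lemma avg_tower:
  assumes "0 < wt s" "card s + i + j \<le> Suc d"
  shows "avg s j (\<lambda>y. avg (s \<union> y) i f) = avg s i f"
proof -
  have s: "finite s" using wt_posD assms by auto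
  have "avg s j (\<lambda>y. avg (s \<union> y) i f) = avg s i (\<lambda>x. avg (s \<union> x) j (\<lambda>y. f x))"
    by (rule avg_swap[OF s, symmetric])
  also have "\<dots> = avg s i f"
  proof (rule avg_cong)
    fix x assume x: "x \<in> lk s i" "0 < wt (s \<union> x)"
    then have "card (s \<union> x) + j \<le> Suc d" using lkD[OF x(1)] s assms by (simp add: card_Un_disjoint)
    then show "avg (s \<union> x) j (\<lambda>y. f x) = f x" by (rule avg_const[OF x(2)])
  qed
  finally show ?thesis .
qed

section \<open>Expansion of complement and containment walks\<close>

lemma sum_link_superfaces:
  assumes s: "0 < wt s" and u: "u \<inter> s = {}"
  shows "sum (link w s) {a \<in> supp (link w s). u \<subseteq> a} = wt (s \<union> u) / wt s"
proof -
  have "sum (link w s) {a \<in> supp (link w s). u \<subseteq> a} = (\<Sum>b\<in>{b \<in> supp w. s \<union> u \<subseteq> b}. w b / wt s)"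
  proof (rule sum.reindex_bij_witness[where i = "\<lambda>b. b - s" and j = "\<lambda>a. a \<union> s"])
    fix a assume "a \<in> {a \<in> supp (link w s). u \<subseteq> a}"
    then have a: "u \<subseteq> a" "a \<inter> s = {}" "w (a \<union> s) \<noteq> 0"
      by (auto simp: supp_def link_def split: if_splits)
    show "a \<union> s - s = a" using a by auto
    show "a \<union> s \<in> {b \<in> supp w. s \<union> u \<subseteq> b}" using a by (auto simp: supp_def)
    show "w (a \<union> s) / wt s = link w s a" using a by (simp add: link_def wt_def)
  next
    fix b assume b: "b \<in> {b \<in> supp w. s \<union> u \<subseteq> b}"
    then have bs: "b - s \<union> s = b" by auto
    show "b - s \<union> s = b" by (rule bs)
    have "w b \<noteq> 0" using b by (simp add: supp_def)
    then have "link w s (b - s) \<noteq> 0" using bs s by (auto simp: link_def wt_def[symmetric])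
    then show "b - s \<in> {a \<in> supp (link w s). u \<subseteq> a}" using b u by (auto simp: supp_def)
  qed
  then show ?thesis by (simp add: wt_def[of "s \<union> u"] sum_divide_distrib)
qed

lemma fprob_link:
  assumes "0 < wt s" "u \<inter> s = {}" "card s \<le> d"
  shows "fprob (link w s) (d - card s) u = pr s (card u) u"
  using sum_link_superfaces[OF assms(1,2)] assms(3)
  by (simp add: fprob_def pr_def Suc_diff_le)

lemma faces_link:
  assumes s: "0 < wt s"
  shows "u \<in> faces (link w s) \<longleftrightarrow> u \<inter> s = {} \<and> 0 < wt (s \<union> u)"
proof
  assume "u \<in> faces (link w s)"
  then obtain a where a: "u \<subseteq> a" "link w s a \<noteq> 0" unfolding faces_def supp_def by auto
  then have "a \<inter> s = {}" "a \<union> s \<in> supp w" by (auto simp: link_def supp_def split: if_splits)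
  then show "u \<inter> s = {} \<and> 0 < wt (s \<union> u)"
    using a unfolding wt_pos_iff faces_def by (auto intro!: bexI[of _ "a \<union> s"])
next
  assume u: "u \<inter> s = {} \<and> 0 < wt (s \<union> u)"
  then obtain b where b: "b \<in> supp w" "s \<union> u \<subseteq> b" unfolding wt_pos_iff faces_def by auto
  then have "b - s \<union> s = b" "w b \<noteq> 0" by (auto simp: supp_def)
  then have "link w s (b - s) \<noteq> 0" using s by (auto simp: link_def wt_def[symmetric])
  then show "u \<in> faces (link w s)"
    unfolding faces_def supp_def using b u by (auto intro!: bexI[of _ "b - s"])
qed

lemma lev_link:
  assumes s: "0 < wt s"
  shows "lev (link w s) k = {u \<in> lk s (Suc k). 0 < wt (s \<union> u)}"
  unfolding lev_def lk_def using faces_link[OF s] wt_posD(2) by auto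

lemma sum_lev_link:
  assumes s: "0 < wt s" and d: "card s \<le> d"
  shows "(\<Sum>u\<in>lev (link w s) k. fprob (link w s) (d - card s) u * F u) = avg s (Suc k) F"
proof -
  have "(\<Sum>u\<in>lev (link w s) k. fprob (link w s) (d - card s) u * F u)
      = (\<Sum>u\<in>{u \<in> lk s (Suc k). 0 < wt (s \<union> u)}. pr s (Suc k) u * F u)"
    unfolding lev_link[OF s] using fprob_link[OF s _ d]
    by (intro sum.cong refl) (auto simp: lk_def)
  also have "\<dots> = avg s (Suc k) F"
    unfolding avg_def
    using wt_nonneg by (intro sum.mono_neutral_left) (auto simp: pr_def order_less_le)
  finally show ?thesis .
qed

lemma link_empty: "link w {} = w"
  using sum_supp by (auto simp: link_def)

lemma sum_lev: "(\<Sum>u\<in>lev w k. fprob w d u * F u) = avg {} (Suc k) F"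
  using sum_lev_link[where s = "{}" and k = k and F = F] wt_empty by (simp add: link_empty)

lemma verts_link: "0 < wt s \<Longrightarrow> verts (link w s) = {v. v \<notin> s \<and> 0 < wt (insert v s)}"
  unfolding verts_def using faces_link by auto

lemma avg_vertices:
  assumes s: "0 < wt s"
  shows "avg s 1 F = (\<Sum>v\<in>verts (link w s). pr s 1 {v} * F {v})"
proof -
  have "avg s 1 F = (\<Sum>u\<in>{u \<in> lk s 1. 0 < wt (s \<union> u)}. pr s 1 u * F u)"
    unfolding avg_def
    using wt_nonneg by (intro sum.mono_neutral_right) (auto simp: pr_def order_less_le)
  also have "{u \<in> lk s 1. 0 < wt (s \<union> u)} = (\<lambda>v. {v}) ` verts (link w s)"
    unfolding verts_link[OF s] lk_def using wt_posD(2)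
    by (auto simp: card_1_singleton_iff)
  also have "(\<Sum>u\<in>(\<lambda>v. {v}) ` verts (link w s). pr s 1 u * F u)
      = (\<Sum>v\<in>verts (link w s). pr s 1 {v} * F {v})"
    by (subst sum.reindex) auto
  finally show ?thesis .
qed

lemma finite_verts_link: "0 < wt s \<Longrightarrow> finite (verts (link w s))"
  by (rule finite_subset[OF _ finite_V]) (use verts_link wt_posD(2) in auto)

text \<open>The factors \<open>wt s\<close> and \<open>N choose 2\<close> cancel in the quotient,
  and \<open>sum_wt_lk\<close> evaluates the normalising sum. A step from \<open>v\<close> is thus a
  draw from the vertex measure of the link of \<open>insert v s\<close>, which identifies the walk
  with averaging over a smaller link.\<close>

lemma walk_link:
  assumes s: "0 < wt s" "card s + 2 \<le> Suc d" and v: "v \<in> verts (link w s)" and uv: "u \<noteq> v"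
    and u: "u \<in> verts (link w s)"
  shows "walk (link w s) (d - card s) v u = pr (insert v s) 1 {u}"
proof -
  define N where "N = Suc d - card s"
  have N2: "N \<ge> 2" using s(2) unfolding N_def by simp
  have ch: "N choose 2 > 0" using N2 by (simp add: zero_less_binomial)
  have vs: "v \<notin> s" "0 < wt (insert v s)" using v verts_link[OF s(1)] by auto
  have fs: "finite s" using wt_posD s(1) by auto
  have fp: "fprob (link w s) (d - card s) {v, u'} = wt (insert v s \<union> {u'}) / (wt s * real (N choose 2))"
    if "u' \<noteq> v" "u' \<in> verts (link w s)" for u'
  proof -
    have "u' \<notin> s" using that verts_link[OF s(1)] by auto
    then show ?thesis
      using fprob_link[OF s(1), of "{v, u'}"] s(2) that vs
      by (simp add: pr_def N_def Un_commute insert_commute numeral_2_eq_2)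
  qed
  have "(\<Sum>u'\<in>verts (link w s) - {v}. fprob (link w s) (d - card s) {v, u'})
      = (\<Sum>u'\<in>verts (link w s) - {v}. wt (insert v s \<union> {u'})) / (wt s * real (N choose 2))"
    unfolding sum_divide_distrib using fp by (intro sum.cong) auto
  also have "(\<Sum>u'\<in>verts (link w s) - {v}. wt (insert v s \<union> {u'}))
      = (\<Sum>u'\<in>V - insert v s. wt (insert v s \<union> {u'}))"
  proof (rule sum.mono_neutral_left)
    show "verts (link w s) - {v} \<subseteq> V - insert v s"
      using verts_link[OF s(1)] wt_posD(2) by auto
    show "\<forall>i\<in>V - insert v s - (verts (link w s) - {v}). wt (insert v s \<union> {i}) = 0"
    proof
      fix i assume i: "i \<in> V - insert v s - (verts (link w s) - {v})"
      then have "\<not> 0 < wt (insert i s)" using verts_link[OF s(1)] by auto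
      then have "wt (insert i s) = 0" using wt_nonneg[of "insert i s"] by simp
      then show "wt (insert v s \<union> {i}) = 0" by (rule wt_zero_mono) auto
    qed
  qed simp
  also have "\<dots> = (\<Sum>u\<in>lk (insert v s) 1. wt (insert v s \<union> u))"
    by (rule sum.reindex_bij_witness[where j = "\<lambda>v. {v}" and i = the_elem])
      (auto simp: lk_def card_1_singleton_iff)
  also have "\<dots> = real ((Suc d - card (insert v s)) choose 1) * wt (insert v s)"
    by (rule sum_wt_lk) (use fs in simp)
  finally show ?thesis
    unfolding walk_def using fp[OF uv u] uv s(1) ch
    by (simp add: pr_def)
qed

text \<open>For sets of sizes \<open>i\<close> and \<open>j\<close> in the link of \<open>s\<close>, this says that the bipartite graph of disjoint
  pairs spanning a face has squared second singular value at most \<open>c\<close>.  The term \<open>c\<close> times the second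
  moment (rather than the variance) makes the property additive under splitting off a vertex.\<close>
definition contr :: "'v set \<Rightarrow> nat \<Rightarrow> nat \<Rightarrow> real \<Rightarrow> bool" where
  "contr s i j c \<longleftrightarrow> (\<forall>f. avg s j (\<lambda>y. (avg (s \<union> y) i f)\<^sup>2)
     \<le> (avg s i f)\<^sup>2 + c * avg s i (\<lambda>x. (f x)\<^sup>2))"

section \<open>Centering, duality and composition of contraction bounds\<close>

lemma avg_centered:
  assumes "0 < wt s" "card s + i + j \<le> Suc d" "y \<in> lk s j" "0 < wt (s \<union> y)"
  shows "avg (s \<union> y) i (\<lambda>x. f x - m) = avg (s \<union> y) i f - m"
proof -
  have "card (s \<union> y) + i \<le> Suc d"
    using assms lkD[OF assms(3)] wt_posD(1)[OF assms(1)] by (simp add: card_Un_disjoint)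
  then show ?thesis using avg_const[OF assms(4)] by (simp add: avg_diff)
qed

text \<open>Applying \<open>contr\<close> to \<open>f\<close> minus its mean removes the squared
  mean and turns the second moment into the variance.\<close>

lemma contr_variance:
  assumes c: "contr s i j c" and s: "0 < wt s" "card s + i + j \<le> Suc d"
  shows "avg s j (\<lambda>y. (avg (s \<union> y) i f - avg s i f)\<^sup>2)
    \<le> c * (avg s i (\<lambda>x. (f x)\<^sup>2) - (avg s i f)\<^sup>2)"
proof -
  define m where "m = avg s i f"
  have "avg s i (\<lambda>x. f x - m) = 0"
    using avg_const[OF s(1), of i m] s(2) by (simp add: avg_diff m_def)
  moreover have "avg s j (\<lambda>y. (avg (s \<union> y) i f - m)\<^sup>2) = avg s j (\<lambda>y. (avg (s \<union> y) i (\<lambda>x. f x - m))\<^sup>2)"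
    by (rule avg_cong) (simp add: avg_centered[OF s])
  moreover have "avg s i (\<lambda>x. (f x - m)\<^sup>2) = avg s i (\<lambda>x. (f x)\<^sup>2) - m\<^sup>2"
    using avg_diff_const_square[OF s(1), of i f m] s(2)
    by (simp add: m_def[symmetric] power2_eq_square)
  ultimately show ?thesis
    using c[unfolded contr_def, rule_format, of "\<lambda>x. f x - m"] by (simp add: m_def)
qed

lemma square_le_mult_imp_le:
  fixes x :: real
  assumes "x\<^sup>2 \<le> c * x" "0 \<le> c"
  shows "x \<le> c"
  using assms by (cases "x \<le> 0") (auto simp: power2_eq_square)

text \<open>An operator and its adjoint have the same singular values. By \<open>avg_swap\<close>
  the variance \<open>W\<close> of one averaging operator is an inner product involving the other;
  Cauchy-Schwarz gives \<open>W^2 \<le> G * (c * W)\<close>, and a factor \<open>W\<close>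
  cancels.\<close>

lemma contr_dual:
  assumes c: "contr s i j c" and s: "0 < wt s" "card s + i + j \<le> Suc d" and c0: "0 \<le> c"
  shows "contr s j i c"
  unfolding contr_def
proof
  fix g
  define m where "m = avg s j g"
  define F where "F x = avg (s \<union> x) j g - m" for x
  define W where "W = avg s i (\<lambda>x. (F x)\<^sup>2)"
  define G where "G = avg s j (\<lambda>y. (g y - m)\<^sup>2)"
  have fs: "finite s" using wt_posD(1)[OF s(1)] .
  have s': "card s + j + i \<le> Suc d" using s(2) by simp
  have ci: "card s + i \<le> Suc d" and cj: "card s + j \<le> Suc d" using s(2) by auto
  have G0: "0 \<le> G" unfolding G_def by (auto intro: avg_nonneg)
  have tow: "avg s i (\<lambda>x. avg (s \<union> x) j g) = m"
    unfolding m_def by (rule avg_tower[OF s(1) s'])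
  have F0: "avg s i F = 0"
    unfolding F_def using tow avg_const[OF s(1) ci, of m] by (simp add: avg_diff)
  have "W = avg s i (\<lambda>x. avg (s \<union> x) j (\<lambda>y. F x * (g y - m)))"
    unfolding W_def
    by (rule avg_cong) (simp add: avg_cmult avg_centered[OF s(1) s'] F_def power2_eq_square)
  also have "\<dots> = avg s j (\<lambda>y. avg (s \<union> y) i (\<lambda>x. F x * (g y - m)))"
    by (rule avg_swap[OF fs])
  also have "\<dots> = avg s j (\<lambda>y. (g y - m) * avg (s \<union> y) i F)"
    by (simp add: avg_cmult_right mult.commute)
  finally have "W\<^sup>2 \<le> G * avg s j (\<lambda>y. (avg (s \<union> y) i F)\<^sup>2)"
    using avg_Cauchy_Schwarz[of s j "\<lambda>y. g y - m" "\<lambda>y. avg (s \<union> y) i F"] by (simp add: G_def)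
  also have "\<dots> \<le> G * (c * W)"
    using c[unfolded contr_def, rule_format, of F] F0 G0 by (intro mult_left_mono) (auto simp: W_def)
  finally have "W\<^sup>2 \<le> (c * G) * W" by (simp add: mult_ac)
  then have W: "W \<le> c * G" by (rule square_le_mult_imp_le) (use c0 G0 in simp)
  have "W = avg s i (\<lambda>x. (avg (s \<union> x) j g)\<^sup>2) - m\<^sup>2"
    unfolding W_def F_def avg_diff_const_square[OF s(1) ci] tow by (simp add: power2_eq_square)
  moreover have "G \<le> avg s j (\<lambda>y. (g y)\<^sup>2)"
    unfolding G_def avg_diff_const_square[OF s(1) cj] m_def[symmetric]
    by (simp add: power2_eq_square)
  then have "c * G \<le> c * avg s j (\<lambda>y. (g y)\<^sup>2)" using c0 by (rule mult_left_mono)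
  ultimately show "avg s i (\<lambda>y. (avg (s \<union> y) j g)\<^sup>2) \<le> (avg s j g)\<^sup>2 + c * avg s j (\<lambda>x. (g x)\<^sup>2)"
    using W by (simp add: m_def)
qed

text \<open>A \<open>Suc j\<close>-set is a vertex \<open>x\<close> and a \<open>j\<close>-set in
  the link of \<open>s \<union> x\<close>. The bound in that link leaves a local second moment,
  which \<open>avg_tower\<close> reassembles into the one over the link of \<open>s\<close>, so the
  constants add.\<close>

lemma contr_Suc:
  assumes s: "0 < wt s" "card s + i + Suc j \<le> Suc d" and c: "0 \<le> c'"
    and 1: "contr s i 1 c"
    and 2: "\<And>x. x \<in> lk s 1 \<Longrightarrow> 0 < wt (s \<union> x) \<Longrightarrow> contr (s \<union> x) i j c'"
  shows "contr s i (Suc j) (c + c')"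
  unfolding contr_def
proof
  fix f
  have fs: "finite s" using wt_posD(1)[OF s(1)] .
  have "avg s (Suc j) (\<lambda>y. (avg (s \<union> y) i f)\<^sup>2)
      = avg s 1 (\<lambda>x. avg (s \<union> x) j (\<lambda>y. (avg (s \<union> x \<union> y) i f)\<^sup>2))"
    using avg_split[OF fs, of 1 j] by (simp add: Un_assoc)
  also have "\<dots> \<le> avg s 1 (\<lambda>x. (avg (s \<union> x) i f)\<^sup>2 + c' * avg (s \<union> x) i (\<lambda>x. (f x)\<^sup>2))"
    using 2 unfolding contr_def by (intro avg_mono) blast
  also have "\<dots> = avg s 1 (\<lambda>x. (avg (s \<union> x) i f)\<^sup>2) + c' * avg s i (\<lambda>x. (f x)\<^sup>2)"
    using avg_tower[OF s(1), of i 1] s(2) by (simp add: avg_add avg_cmult)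
  also have "\<dots> \<le> (avg s i f)\<^sup>2 + (c + c') * avg s i (\<lambda>x. (f x)\<^sup>2)"
    using 1[unfolded contr_def, rule_format, of f] by (simp add: algebra_simps)
  finally show "avg s (Suc j) (\<lambda>y. (avg (s \<union> y) i f)\<^sup>2)
      \<le> (avg s i f)\<^sup>2 + (c + c') * avg s i (\<lambda>x. (f x)\<^sup>2)" .
qed

end

section \<open>Contraction in link expanders\<close>

locale link_expander = weighted_complex w d for w :: "'v set \<Rightarrow> real" and d +
  fixes lam :: real
  assumes expander: "two_sided_link_expander w d lam" and lam: "0 < lam" "lam < 1"
begin

text \<open>Averaging over neighbours is multiplication by the walk matrix, and it is reversible for
  the vertex measure because both sides of detailed balance are an edge weight up to the same
  factor. The spectral contraction is applied to the centred function. The size condition brings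
  \<open>s\<close> into the range of the expander definition.\<close>

lemma contr_vertices:
  assumes s: "0 < wt s" "card s + 2 \<le> Suc d"
  shows "contr s 1 1 (lam\<^sup>2)"
proof -
  let ?y = "link w s" and ?n = "d - card s"
  \<comment> \<open>This is the choice term of \<open>walk_mat\<close>, so that the expansion
    hypothesis speaks about \<open>A\<close> itself.\<close>
  define vs where "vs = (SOME vs. distinct vs \<and> set vs = verts ?y)"
  have vs: "distinct vs" "set vs = verts ?y"
    unfolding vs_def using someI_ex[of "\<lambda>vs. distinct vs \<and> set vs = verts ?y"]
      finite_distinct_list[OF finite_verts_link[OF s(1)]] by blast+
  define n where "n = length vs"
  define A where "A = mat n n (\<lambda>(i, j). walk ?y ?n (vs ! i) (vs ! j))"
  have Awm: "walk_mat ?y ?n = A"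
    unfolding walk_mat_def A_def n_def vs_def[symmetric] Let_def by simp
  have reidx: "(\<Sum>v\<in>verts ?y. g v) = (\<Sum>i<n. g (vs ! i))" for g :: "'v \<Rightarrow> real"
    unfolding vs(2)[symmetric] n_def
    using sum.reindex_bij_betw[OF bij_betw_nth[OF vs(1) refl refl], of g] by simp
  have vi: "vs ! i \<in> verts ?y" if "i < n" for i
    using nth_mem[of i vs] that unfolding vs(2) n_def by blast
  define p where "p i = pr s 1 {vs ! i}" for i
  have av: "avg s 1 F = (\<Sum>i<n. p i * F {vs ! i})" for F
    unfolding avg_vertices[OF s(1)] reidx p_def ..
  have Nc: "Suc d - card s > 0" using s by simp
  have p: "0 < p i" if "i < n" for i
  proof -
    have "0 < wt (s \<union> {vs ! i})" using vi[OF that] unfolding verts_link[OF s(1)] by simp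
    then show ?thesis using s(1) Nc by (simp add: p_def pr_def)
  qed
  have Aij: "A $$ (i, j) = (if i = j then 0 else pr (insert (vs ! i) s) 1 {vs ! j})"
    if "i < n" "j < n" for i j
    using that walk_link[OF s vi[of i] _ vi[of j]] nth_eq_iff_index_eq[OF vs(1), of i j]
    by (auto simp: A_def n_def walk_def)
  have avl: "avg (s \<union> {vs ! i}) 1 F = (\<Sum>j<n. A $$ (i, j) * F {vs ! j})" if i: "i < n" for i F
  proof -
    let ?v = "vs ! i"
    have v: "?v \<notin> s" "0 < wt (insert ?v s)" using vi[OF i] verts_link[OF s(1)] by auto
    have "avg (s \<union> {?v}) 1 F = (\<Sum>u\<in>verts (link w (insert ?v s)). pr (insert ?v s) 1 {u} * F {u})"
      using avg_vertices[OF v(2), of F] by simp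
    also have "\<dots> = (\<Sum>u\<in>verts ?y. (if u = ?v then 0 else pr (insert ?v s) 1 {u}) * F {u})"
    proof (rule sum.mono_neutral_cong_left)
      show "verts (link w (insert ?v s)) \<subseteq> verts ?y"
        unfolding verts_link[OF s(1)] verts_link[OF v(2)]
        using wt_pos_mono[of "insert u (insert (vs ! i) s)" "insert u s" for u] by blast
      show "\<forall>u\<in>verts ?y - verts (link w (insert ?v s)).
          (if u = ?v then 0 else pr (insert ?v s) 1 {u}) * F {u} = 0"
        unfolding verts_link[OF s(1)] verts_link[OF v(2)]
        using wt_nonneg by (auto simp: pr_def insert_commute order_less_le)
    qed (use verts_link[OF v(2)] finite_verts_link[OF s(1)] in auto)
    also have "\<dots> = (\<Sum>j<n. A $$ (i, j) * F {vs ! j})"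
      unfolding reidx using i Aij nth_eq_iff_index_eq[OF vs(1)] n_def
      by (intro sum.cong refl) auto
    finally show ?thesis .
  qed
  have dc: "Suc d - card (insert (vs ! i) s) = d - card s" if "i < n" for i
    using vi[OF that] verts_link[OF s(1)] wt_posD(1)[OF s(1)] by simp
  have rev: "p i * A $$ (i, j) = p j * A $$ (j, i)" if "i < n" "j < n" for i j
    using that vi[OF that(1)] vi[OF that(2)] verts_link[OF s(1)]
    by (auto simp: Aij p_def pr_def dc insert_commute)
  have psum: "(\<Sum>i<n. p i) = 1"
    using av[of "\<lambda>_. 1"] avg_const[OF s(1), of 1 1] s(2) by simp
  have row: "(\<Sum>j<n. A $$ (i, j)) = 1" if i: "i < n" for i
  proof -
    have "0 < wt (s \<union> {vs ! i})" using vi[OF i] verts_link[OF s(1)] by simp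
    moreover have "card (s \<union> {vs ! i}) + 1 \<le> Suc d"
      using s(2) vi[OF i] verts_link[OF s(1)] wt_posD(1)[OF s(1)] by simp
    ultimately show ?thesis using avl[OF i, of "\<lambda>_. 1"] avg_const[of _ 1 1] by simp
  qed
  have "s \<in> faces w" using s(1) wt_pos_iff by blast
  then have eigs: "nontop_eigs_bounded A lam"
    using expander s(2) unfolding two_sided_link_expander_def Awm[symmetric] by auto
  show ?thesis
    unfolding contr_def
  proof
    fix f
    define m where "m = avg s 1 f"
    have s11: "card s + 1 + 1 \<le> Suc d" "card s + 1 \<le> Suc d" using s(2) by auto
    have z: "(\<Sum>i<n. p i * (f {vs ! i} - m)) = 0"
      using av[of "\<lambda>x. f x - m"] avg_const[OF s(1) s11(2), of m] by (simp add: avg_diff m_def)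
    have "(\<Sum>i<n. p i * (\<Sum>j<n. A $$ (i, j) * (f {vs ! j} - m))\<^sup>2)
        \<le> lam\<^sup>2 * (\<Sum>i<n. p i * (f {vs ! i} - m)\<^sup>2)"
      by (rule reversible_walk_contraction[OF _ p psum rev row eigs lam z]) (auto simp: A_def)
    then have "avg s 1 (\<lambda>y. (avg (s \<union> y) 1 (\<lambda>x. f x - m))\<^sup>2) \<le> lam\<^sup>2 * avg s 1 (\<lambda>x. (f x - m)\<^sup>2)"
      using av avl by simp
    moreover have "avg s 1 (\<lambda>y. (avg (s \<union> y) 1 (\<lambda>x. f x - m))\<^sup>2)
        = avg s 1 (\<lambda>y. (avg (s \<union> y) 1 f)\<^sup>2) - m\<^sup>2"
    proof -
      have "avg s 1 (\<lambda>y. (avg (s \<union> y) 1 (\<lambda>x. f x - m))\<^sup>2) = avg s 1 (\<lambda>y. (avg (s \<union> y) 1 f - m)\<^sup>2)"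
        by (rule avg_cong) (simp add: avg_centered[OF s(1) s11(1)] del: One_nat_def)
      then show ?thesis
        unfolding avg_diff_const_square[OF s(1) s11(2)] avg_tower[OF s(1) s11(1)]
        by (simp add: m_def[symmetric] power2_eq_square del: One_nat_def)
    qed
    moreover have "avg s 1 (\<lambda>x. (f x - m)\<^sup>2) \<le> avg s 1 (\<lambda>x. (f x)\<^sup>2)"
      unfolding avg_diff_const_square[OF s(1) s11(2)] m_def[symmetric]
      by (simp add: power2_eq_square del: One_nat_def)
    then have "lam\<^sup>2 * avg s 1 (\<lambda>x. (f x - m)\<^sup>2) \<le> lam\<^sup>2 * avg s 1 (\<lambda>x. (f x)\<^sup>2)"
      by (rule mult_left_mono) simp
    ultimately show "avg s 1 (\<lambda>y. (avg (s \<union> y) 1 f)\<^sup>2) \<le> (avg s 1 f)\<^sup>2 + lam\<^sup>2 * avg s 1 (\<lambda>x. (f x)\<^sup>2)"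
      by (simp add: m_def)
  qed
qed

text \<open>Each vertex added to the second face costs \<open>real i * lam^2\<close>. The base case
  ranges over all links because the induction moves into the link of the added vertex.\<close>

lemma contr_faces_iterate:
  assumes base: "\<And>s. 0 < wt s \<Longrightarrow> card s + i + 1 \<le> Suc d \<Longrightarrow> contr s i 1 (real i * lam\<^sup>2)"
  shows "0 < wt s \<Longrightarrow> card s + i + Suc j \<le> Suc d \<Longrightarrow> contr s i (Suc j) (real i * real (Suc j) * lam\<^sup>2)"
proof (induction j arbitrary: s)
  case 0
  then show ?case using base[of s] by simp
next
  case (Suc j)
  have "contr s i (Suc (Suc j)) (real i * lam\<^sup>2 + real i * real (Suc j) * lam\<^sup>2)"
  proof (rule contr_Suc)
    show "contr s i 1 (real i * lam\<^sup>2)" using base Suc.prems by simp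
    fix x assume x: "x \<in> lk s 1" "0 < wt (s \<union> x)"
    then have "card (s \<union> x) = card s + 1"
      using lkD[OF x(1)] wt_posD(1)[OF Suc.prems(1)] by (simp add: card_Un_disjoint)
    then show "contr (s \<union> x) i (Suc j) (real i * real (Suc j) * lam\<^sup>2)"
      using Suc.IH[OF x(2)] Suc.prems by simp
  qed (use Suc.prems in auto)
  then show ?case by (simp add: algebra_simps)
qed

text \<open>The iteration enlarges one side only, so the sizes go from \<open>(1, 1)\<close> to
  \<open>(1, Suc i)\<close>, by duality to \<open>(Suc i, 1)\<close>, and then to
  \<open>(Suc i, Suc j)\<close>.\<close>

theorem contr_faces:
  assumes s: "0 < wt s" "card s + Suc i + Suc j \<le> Suc d"
  shows "contr s (Suc i) (Suc j) (real (Suc i) * real (Suc j) * lam\<^sup>2)"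
proof (rule contr_faces_iterate[OF _ s])
  fix s assume s: "0 < wt s" "card s + Suc i + 1 \<le> Suc d"
  have "contr s 1 (Suc i) (real 1 * real (Suc i) * lam\<^sup>2)"
  proof (rule contr_faces_iterate)
    show "contr s 1 1 (real 1 * lam\<^sup>2)" if "0 < wt s" "card s + 1 + 1 \<le> Suc d" for s
      using contr_vertices[of s] that by simp
  qed (use s in auto)
  then have "contr s 1 (Suc i) (real (Suc i) * lam\<^sup>2)" by simp
  then show "contr s (Suc i) 1 (real (Suc i) * lam\<^sup>2)"
    by (rule contr_dual) (use s in auto)
qed

text \<open>The adjoint operator sums the centred vertex function \<open>g\<close> over
  \<open>t\<close>, giving \<open>U\<close>. Pairing \<open>U\<close> with \<open>\<phi>\<close>
  yields \<open>J * W\<close>. The second moment of \<open>U\<close> consists of diagonal terms and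
  of pairs of distinct vertices; such pairs are random edges, so their correlation is at most
  \<open>lam * W\<close>. Cauchy-Schwarz and cancelling \<open>W\<close> finish.\<close>

lemma containment_variance:
  assumes s: "0 < wt s" "card s + Suc n \<le> Suc d" and n: "1 \<le> n"
  shows "avg s 1 (\<lambda>x. (avg (s \<union> x) n (\<lambda>y. \<phi> (x \<union> y)) - avg s (Suc n) \<phi>)\<^sup>2)
    \<le> (1 / real (Suc n) + lam) * avg s (Suc n) (\<lambda>t. (\<phi> t)\<^sup>2)"
proof -
  define m where "m = avg s (Suc n) \<phi>"
  define h where "h x = avg (s \<union> x) n (\<lambda>y. \<phi> (x \<union> y))" for x
  define g where "g x = h x - m" for x
  define W where "W = avg s 1 (\<lambda>x. (g x)\<^sup>2)"
  define J where "J = real (Suc n)"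
  define U where "U t = (\<Sum>x\<in>{x. x \<subseteq> t \<and> card x = 1}. g x)" for t
  have J: "J > 0" "real n = J - 1" unfolding J_def by auto
  have fs: "finite s" using wt_posD(1)[OF s(1)] .
  have W0: "0 \<le> W" unfolding W_def by (auto intro: avg_nonneg)
  have s1: "card s + 1 \<le> Suc d" using s(2) by simp
  have hm: "avg s 1 h = m" unfolding h_def m_def using avg_split[OF fs, of 1 n \<phi>] by simp
  have g0: "avg s 1 g = 0" unfolding g_def avg_diff using hm avg_const[OF s(1) s1, of m] by simp
  have marked: "avg s (Suc n) (\<lambda>t. \<Sum>x\<in>{x. x \<subseteq> t \<and> card x = 1}. F x (t - x))
      = J * avg s 1 (\<lambda>x. avg (s \<union> x) n (F x))" for F
    using avg_marked[OF fs, of 1 n F] by (simp add: J_def)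
  have "W = avg s 1 (\<lambda>x. g x * h x) - m * avg s 1 g"
    unfolding W_def avg_cmult[symmetric] avg_diff[symmetric]
    by (rule avg_cong) (simp add: g_def power2_eq_square algebra_simps)
  also have "\<dots> = avg s 1 (\<lambda>x. avg (s \<union> x) n (\<lambda>y. g x * \<phi> (x \<union> y)))"
    by (simp add: g0 h_def avg_cmult del: One_nat_def)
  finally have "J * W = avg s (Suc n) (\<lambda>t. \<Sum>x\<in>{x. x \<subseteq> t \<and> card x = 1}. g x * \<phi> (x \<union> (t - x)))"
    using marked[of "\<lambda>x y. g x * \<phi> (x \<union> y)"] by simp
  also have "\<dots> = avg s (Suc n) (\<lambda>t. U t * \<phi> t)"
    unfolding U_def sum_distrib_right
    by (intro avg_cong sum.cong refl) (auto intro!: arg_cong[where f = \<phi>])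
  finally have JW: "(J * W)\<^sup>2 \<le> avg s (Suc n) (\<lambda>t. (U t)\<^sup>2) * avg s (Suc n) (\<lambda>t. (\<phi> t)\<^sup>2)"
    using avg_Cauchy_Schwarz[of s "Suc n" U \<phi>] by simp
  define X where "X = avg s 1 (\<lambda>x. g x * avg (s \<union> x) 1 g)"
  have UU: "avg s (Suc n) (\<lambda>t. (U t)\<^sup>2) = J * (W + real n * X)"
  proof -
    have "avg s (Suc n) (\<lambda>t. (U t)\<^sup>2)
        = avg s (Suc n) (\<lambda>t. \<Sum>x\<in>{x. x \<subseteq> t \<and> card x = 1}. g x * (g x + U (t - x)))"
    proof (rule avg_cong)
      fix t assume "t \<in> lk s (Suc n)"
      then have t: "finite t" using lkD by blast
      have Ut: "U t = g x + U (t - x)" if x: "x \<subseteq> t" "card x = 1" for x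
      proof -
        have e: "{x'. x' \<subseteq> t \<and> card x' = 1} = insert x {x'. x' \<subseteq> t - x \<and> card x' = 1}"
          using x by (auto simp: card_1_singleton_iff)
        have "x \<notin> {x'. x' \<subseteq> t - x \<and> card x' = 1}" using x by (auto simp: card_1_singleton_iff)
        moreover have "finite {x'. x' \<subseteq> t - x \<and> card x' = 1}" using t by simp
        ultimately show ?thesis unfolding U_def e by simp
      qed
      have "(U t)\<^sup>2 = (\<Sum>x\<in>{x. x \<subseteq> t \<and> card x = 1}. g x) * U t"
        unfolding power2_eq_square U_def ..
      also have "\<dots> = (\<Sum>x\<in>{x. x \<subseteq> t \<and> card x = 1}. g x * (g x + U (t - x)))"
        unfolding sum_distrib_right by (intro sum.cong refl) (use Ut in auto)
      finally show "(U t)\<^sup>2 = (\<Sum>x\<in>{x. x \<subseteq> t \<and> card x = 1}. g x * (g x + U (t - x)))" .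
    qed
    also have "\<dots> = J * avg s 1 (\<lambda>x. avg (s \<union> x) n (\<lambda>y. g x * (g x + U y)))"
      by (rule marked)
    also have "avg s 1 (\<lambda>x. avg (s \<union> x) n (\<lambda>y. g x * (g x + U y)))
        = avg s 1 (\<lambda>x. (g x)\<^sup>2 + real n * (g x * avg (s \<union> x) 1 g))"
    proof (rule avg_cong)
      fix x assume x: "x \<in> lk s 1" "0 < wt (s \<union> x)"
      have cx: "card (s \<union> x) = card s + 1"
        using lkD[OF x(1)] fs by (simp add: card_Un_disjoint)
      have c1: "avg (s \<union> x) n (\<lambda>y. g x) = g x"
        by (rule avg_const[OF x(2)]) (use cx s(2) in simp)
      \<comment> \<open>A second vertex is marked among the remaining \<open>n\<close>; the other
        \<open>n'\<close> vertices average out and an edge remains.\<close>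
      obtain n' where n': "n = Suc n'" using n by (cases n) auto
      have "avg (s \<union> x) n U = real n * avg (s \<union> x) 1 (\<lambda>x'. avg (s \<union> x \<union> x') n' (\<lambda>_. g x'))"
        unfolding U_def n' using avg_marked[of "s \<union> x" 1 n' "\<lambda>x' _. g x'"] wt_posD(1)[OF x(2)] by simp
      also have "avg (s \<union> x) 1 (\<lambda>x'. avg (s \<union> x \<union> x') n' (\<lambda>_. g x')) = avg (s \<union> x) 1 g"
      proof (rule avg_cong)
        fix x' assume x': "x' \<in> lk (s \<union> x) 1" "0 < wt (s \<union> x \<union> x')"
        have "card (s \<union> x \<union> x') = card s + 2"
          using lkD[OF x'(1)] wt_posD(1)[OF x(2)] cx by (subst card_Un_disjoint) auto
        then show "avg (s \<union> x \<union> x') n' (\<lambda>_. g x') = g x'"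
          by (intro avg_const[OF x'(2)]) (use s(2) n' in simp)
      qed
      finally show "avg (s \<union> x) n (\<lambda>y. g x * (g x + U y)) = (g x)\<^sup>2 + real n * (g x * avg (s \<union> x) 1 g)"
        unfolding avg_cmult avg_add c1 by (simp add: power2_eq_square algebra_simps)
    qed
    finally show ?thesis unfolding avg_add avg_cmult W_def X_def .
  qed
  have "X\<^sup>2 \<le> W * avg s 1 (\<lambda>x. (avg (s \<union> x) 1 g)\<^sup>2)"
    unfolding X_def W_def by (rule avg_Cauchy_Schwarz)
  also have "\<dots> \<le> W * (lam\<^sup>2 * W)"
    using contr_vertices[OF s(1)] s(2) n g0 W0 unfolding contr_def
    by (intro mult_left_mono) (auto simp: W_def dest!: spec[of _ g])
  finally have "X\<^sup>2 \<le> (lam * W)\<^sup>2" by (simp add: power2_eq_square mult_ac)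
  then have X: "X \<le> lam * W" using lam W0 by (intro power2_le_imp_le[of X]) auto
  define P where "P = avg s (Suc n) (\<lambda>t. (\<phi> t)\<^sup>2)"
  have P0: "0 \<le> P" unfolding P_def by (auto intro: avg_nonneg)
  have "W + real n * X \<le> W + J * (lam * W)"
  proof -
    have "real n * X \<le> real n * (lam * W)" using X by (rule mult_left_mono) simp
    also have "\<dots> \<le> J * (lam * W)" using lam W0 J by (intro mult_right_mono) auto
    finally show ?thesis by simp
  qed
  then have "(J * W)\<^sup>2 \<le> J * (W + J * (lam * W)) * P"
    using order.trans[OF JW[folded P_def, unfolded UU]] P0 J by (simp add: mult_left_mono mult_right_mono)
  also have "\<dots> = J\<^sup>2 * (((1 / J + lam) * P) * W)"
  proof -
    have "J * (1 / J + lam) = 1 + J * lam" using J(1) by (simp add: distrib_left)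
    then have "J\<^sup>2 * (((1 / J + lam) * P) * W) = J * ((1 + J * lam) * P * W)"
      by (metis mult.assoc power2_eq_square)
    then show ?thesis by (simp add: algebra_simps)
  qed
  finally have "J\<^sup>2 * W\<^sup>2 \<le> J\<^sup>2 * (((1 / J + lam) * P) * W)"
    by (simp add: power_mult_distrib)
  then have "W\<^sup>2 \<le> ((1 / J + lam) * P) * W" using J by simp
  then have "W \<le> (1 / J + lam) * P"
    by (rule square_le_mult_imp_le) (use J lam P0 in simp)
  then show ?thesis unfolding W_def g_def h_def m_def P_def J_def .
qed

end

section \<open>Cuts with few crossing edges\<close>

context weighted_complex
begin

text \<open>The minimum over faces of positive probability is at most the mean. With
  \<open>F = 0\<close> this serves as mere existence of such a face.\<close>

lemma avg_exists_le:
  assumes s: "0 < wt s" "card s + j \<le> Suc d"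
  obtains u where "u \<in> lk s j" "0 < wt (s \<union> u)" "F u \<le> avg s j F"
proof -
  define A where "A = {u \<in> lk s j. 0 < wt (s \<union> u)}"
  have fin: "finite A" unfolding A_def by simp
  have ne: "A \<noteq> {}"
  proof
    assume "A = {}"
    then have "\<not> 0 < wt (s \<union> u)" if "u \<in> lk s j" for u using that unfolding A_def by simp
    then have "avg s j (\<lambda>_. 1) \<le> avg s j (\<lambda>_. 0)" by (intro avg_mono) simp
    then show False using avg_const[OF s, of 1] by simp
  qed
  have "Min (F ` A) \<in> F ` A" by (rule Min_in) (use fin ne in auto)
  then obtain u where u: "u \<in> A" "Min (F ` A) = F u" by (rule imageE)
  have "avg s j (\<lambda>_. F u) \<le> avg s j F"
  proof (rule avg_mono)
    fix v assume "v \<in> lk s j" "0 < wt (s \<union> v)"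
    then have "F v \<in> F ` A" unfolding A_def by simp
    then show "F u \<le> F v" unfolding u(2)[symmetric] using fin by simp
  qed
  then have "F u \<le> avg s j F" unfolding avg_const[OF s] .
  then show ?thesis using u(1) that unfolding A_def by blast
qed

text \<open>Averaging over the label classes: inside a class of probability \<open>p\<close> the complement walk
  exceeds the independent value \<open>p\<^sup>2\<close> by at most \<open>\<mu> (p - p\<^sup>2)\<close>.\<close>
lemma disagreement_complement_walk:
  fixes \<kappa> :: "'v set \<Rightarrow> 'b"
  assumes s: "0 < wt s" "card s + K + K \<le> Suc d" and c: "contr s K K (\<mu>\<^sup>2)" and \<mu>: "0 \<le> \<mu>"
  shows "(1 - \<mu>) * avg s K (\<lambda>x. avg s K (\<lambda>y. of_bool (\<kappa> x \<noteq> \<kappa> y)))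
    \<le> avg s K (\<lambda>x. avg (s \<union> x) K (\<lambda>y. of_bool (\<kappa> x \<noteq> \<kappa> y)))"
proof -
  define R where "R = \<kappa> ` lk s K"
  define C where "C r x = (of_bool (\<kappa> x = r) :: real)" for r x
  define p where "p r = avg s K (C r)" for r
  have sK: "card s + K \<le> Suc d" using s(2) by simp
  have fs: "finite s" using wt_posD(1)[OF s(1)] .
  have finR: "finite R" unfolding R_def by simp
  have disagree: "of_bool (\<kappa> x \<noteq> \<kappa> y) = 1 - (\<Sum>r\<in>R. C r x * C r y)" if "x \<in> lk s K" for x y
  proof -
    have "(\<Sum>r\<in>R. C r x * C r y) = (\<Sum>r\<in>R. if r = \<kappa> x then C r y else 0)"
      by (intro sum.cong) (auto simp: C_def)
    also have "\<dots> = C (\<kappa> x) y" using that finR by (simp add: R_def)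
    finally show ?thesis by (auto simp: C_def)
  qed
  have psum: "(\<Sum>r\<in>R. p r) = 1"
  proof -
    have "(\<Sum>r\<in>R. p r) = avg s K (\<lambda>x. \<Sum>r\<in>R. C r x)" unfolding p_def by (rule avg_sum[symmetric])
    also have "\<dots> = avg s K (\<lambda>_. 1)"
    proof (rule avg_cong)
      fix x assume "x \<in> lk s K"
      then have "\<kappa> x \<in> R" unfolding R_def by (rule imageI)
      then show "(\<Sum>r\<in>R. C r x) = 1"
        unfolding C_def of_bool_def by (subst sum.delta'[OF finR]) simp
    qed
    finally show ?thesis using avg_const[OF s(1) sK] by simp
  qed
  have ind: "avg s K (\<lambda>x. avg s K (\<lambda>y. of_bool (\<kappa> x \<noteq> \<kappa> y))) = 1 - (\<Sum>r\<in>R. p r * p r)"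
  proof -
    have "avg s K (\<lambda>x. avg s K (\<lambda>y. of_bool (\<kappa> x \<noteq> \<kappa> y)))
        = avg s K (\<lambda>x. 1 - (\<Sum>r\<in>R. C r x * p r))"
      by (rule avg_cong) (simp add: disagree avg_diff avg_const[OF s(1) sK] avg_sum avg_cmult p_def)
    also have "\<dots> = 1 - (\<Sum>r\<in>R. p r * p r)"
      by (simp add: avg_diff avg_const[OF s(1) sK] avg_sum avg_cmult_right p_def)
    finally show ?thesis .
  qed
  define S where "S r = avg s K (\<lambda>x. C r x * avg (s \<union> x) K (C r))" for r
  have com: "avg s K (\<lambda>x. avg (s \<union> x) K (\<lambda>y. of_bool (\<kappa> x \<noteq> \<kappa> y))) = 1 - (\<Sum>r\<in>R. S r)"
  proof -
    have "avg s K (\<lambda>x. avg (s \<union> x) K (\<lambda>y. of_bool (\<kappa> x \<noteq> \<kappa> y)))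
        = avg s K (\<lambda>x. 1 - (\<Sum>r\<in>R. C r x * avg (s \<union> x) K (C r)))"
    proof (rule avg_cong)
      fix x assume x: "x \<in> lk s K" "0 < wt (s \<union> x)"
      have "card (s \<union> x) + K \<le> Suc d" using lkD[OF x(1)] fs s(2) by (simp add: card_Un_disjoint)
      then show "avg (s \<union> x) K (\<lambda>y. of_bool (\<kappa> x \<noteq> \<kappa> y)) = 1 - (\<Sum>r\<in>R. C r x * avg (s \<union> x) K (C r))"
        by (simp add: disagree[OF x(1)] avg_diff avg_const[OF x(2)] avg_sum avg_cmult)
    qed
    also have "\<dots> = 1 - (\<Sum>r\<in>R. S r)"
      by (simp add: avg_diff avg_const[OF s(1) sK] avg_sum S_def)
    finally show ?thesis .
  qed
  \<comment> \<open>The excess over \<open>p r * p r\<close> is the covariance of the class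
    indicator with its image under the walk; Cauchy-Schwarz and the variance contraction bound it by
    \<open>\<mu>\<close> times the variance of the indicator.\<close>
  have SR: "S r \<le> p r * p r + \<mu> * (p r - p r * p r)" for r
  proof -
    define q where "q = p r - (p r)\<^sup>2"
    define D where "D x = avg (s \<union> x) K (C r) - p r" for x
    have C2: "(C r x)\<^sup>2 = C r x" for x by (simp add: C_def)
    have "(p r)\<^sup>2 \<le> p r" using avg_square_le[OF s(1) sK, of "C r"] by (simp add: C2 p_def)
    then have q0: "0 \<le> q" by (simp add: q_def)
    have tow: "avg s K (\<lambda>x. avg (s \<union> x) K (C r)) = p r"
      unfolding p_def by (rule avg_tower[OF s])
    have "avg s K (\<lambda>x. (C r x - p r) * D x)
        = avg s K (\<lambda>x. (C r x * avg (s \<union> x) K (C r) - p r * C r x)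
            - (p r * avg (s \<union> x) K (C r) - p r * p r))"
      by (rule avg_cong) (simp add: D_def algebra_simps)
    also have "\<dots> = S r - p r * p r"
      unfolding avg_diff avg_cmult tow avg_const[OF s(1) sK] by (simp add: S_def p_def)
    finally have e: "S r - p r * p r = avg s K (\<lambda>x. (C r x - p r) * D x)" by simp
    have "(S r - p r * p r)\<^sup>2 \<le> avg s K (\<lambda>x. (C r x - p r)\<^sup>2) * avg s K (\<lambda>x. (D x)\<^sup>2)"
      unfolding e by (rule avg_Cauchy_Schwarz)
    also have "avg s K (\<lambda>x. (C r x - p r)\<^sup>2) = q"
      unfolding avg_diff_const_square[OF s(1) sK] C2 p_def[symmetric]
      by (simp add: q_def power2_eq_square)
    also have "q * avg s K (\<lambda>x. (D x)\<^sup>2) \<le> q * (\<mu>\<^sup>2 * q)"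
      using contr_variance[OF c s, of "C r"] q0
      by (intro mult_left_mono) (simp_all add: C2 p_def[symmetric] D_def q_def)
    also have "\<dots> = (\<mu> * q)\<^sup>2" by (simp add: power2_eq_square)
    finally have "S r - p r * p r \<le> \<mu> * q"
      by (rule power2_le_imp_le) (use \<mu> q0 in simp)
    then show ?thesis by (simp add: q_def power2_eq_square)
  qed
  \<comment> \<open>As the \<open>p r\<close> sum to 1, the excesses add up to \<open>\<mu>\<close>
    times the independent disagreement probability.\<close>
  have "(\<Sum>r\<in>R. S r) \<le> (\<Sum>r\<in>R. p r * p r + \<mu> * (p r - p r * p r))"
    using SR by (intro sum_mono)
  also have "\<dots> = (\<Sum>r\<in>R. p r * p r) + \<mu> * (1 - (\<Sum>r\<in>R. p r * p r))"
    by (simp add: sum.distrib sum_distrib_left[symmetric] sum_subtractf psum)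
  finally show ?thesis unfolding ind com by (simp add: algebra_simps)
qed

text \<open>A bootstrap on the mixing bound \<open>x\<close>. Used crudely, it gives
  \<open>B \<le> 21/100\<close>; then \<open>Y - B * c\<close> is at least a fixed fraction of
  \<open>c\<close>, so \<open>x\<close> gives \<open>c \<le> 22/10 * (B * M)\<close>. Feeding this
  back into \<open>x\<close> gives \<open>B \<le> 23 * \<eta>\<close>, and the two bounds
  multiply.\<close>

lemma cut_arithmetic:
  fixes c B Y M \<eta> :: real
  assumes Y: "9/10 * c \<le> Y" and B: "B \<le> 11 * \<eta> + Y" and x: "(Y - B * c)\<^sup>2 \<le> B * (M * c)"
    and c: "0 \<le> c" "c \<le> 1/2" and B01: "0 \<le> B" "B \<le> 1" and M: "0 \<le> M" "M \<le> 1/256"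
    and \<eta>: "\<eta> \<le> 1/200"
  shows "c \<le> 100 * (M * \<eta>)"
proof (cases "c = 0")
  case True
  have "0 \<le> M * \<eta>"
  \<comment> \<open>A negative \<open>\<eta>\<close> would force \<open>Y > 0\<close> through the
    bound on \<open>B\<close>, whereas \<open>x\<close> forces \<open>Y = 0\<close>.\<close>
  proof (cases "\<eta> \<ge> 0")
    case False
    with True B x B01 have "Y > 0" "Y\<^sup>2 \<le> 0" by auto
    then show ?thesis by simp
  qed (use M in simp)
  then show ?thesis using True by simp
next
  case False
  then have c0: "c > 0" using c by simp
  have Bc: "B * c \<le> B / 2" using mult_left_mono[OF c(2) B01(1)] by simp
  have "B * (M * c) \<le> 1 * (1/256 * (1/2))"
    using B01 M c by (intro mult_mono) auto
  also have "\<dots> \<le> (1/22)\<^sup>2" by (simp add: power2_eq_square)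
  finally have "Y - B * c \<le> 1/22"
    using x by (intro power2_le_imp_le[of "Y - B * c" "1/22"]) auto
  then have B2: "B \<le> 21/100" using B Bc \<eta> by simp
  have "B * c \<le> 21/100 * c" using B2 c by (intro mult_right_mono) auto
  then have "69/100 * c \<le> Y - B * c" using Y by simp
  then have "(69/100 * c)\<^sup>2 \<le> (Y - B * c)\<^sup>2" by (rule power_mono) (use c in simp)
  then have "(69/100 * c)\<^sup>2 \<le> B * (M * c)" using x by (rule order.trans)
  then have "(4761/10000 * c) * c \<le> (B * M) * c" by (simp add: power2_eq_square mult_ac)
  then have c1: "4761/10000 * c \<le> B * M" using c0 by simp
  have BM0: "0 \<le> B * M" using B01 M by simp
  have c2: "c \<le> 22/10 * (B * M)" using c1 BM0 by simp
  have "B * (M * c) \<le> (B * M) * (22/10 * (B * M))"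
    using mult_left_mono[OF c2 BM0] by (simp add: mult_ac)
  also have "\<dots> = 22/10 * (B * M)\<^sup>2" by (simp add: power2_eq_square)
  also have "\<dots> \<le> (3/2)\<^sup>2 * (B * M)\<^sup>2" by (intro mult_right_mono) (simp_all add: power2_eq_square)
  also have "\<dots> = (3/2 * (B * M))\<^sup>2" by (rule power_mult_distrib[symmetric])
  finally have "Y - B * c \<le> 3/2 * (B * M)"
    using x BM0 by (intro power2_le_imp_le[of "Y - B * c"]) auto
  also have "\<dots> \<le> 3/2 * (B * (1/256))" using B01 M by (intro mult_left_mono) auto
  finally have "B \<le> 23 * \<eta>" using B Bc B01 by simp
  then have "B * M \<le> 23 * \<eta> * M" using M by (intro mult_right_mono) auto
  moreover have "0 \<le> \<eta> * M" using \<open>B \<le> 23 * \<eta>\<close> B01 M by simp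
  ultimately show ?thesis using c2 by (simp add: mult_ac)
qed

text \<open>The two sides of the cut are \<open>C\<close> and the set of \<open>a\<close> with
  \<open>glab a \<in> T\<close>. A pair with one label in \<open>T\<close> and the other outside is
  bad, so members of \<open>C\<close> send at least 9/10 of their edges across, while few other
  edges reach those \<open>a\<close>. Expansion allows this only for a tiny \<open>C\<close>, with
  gain \<open>M\<close>.\<close>

lemma small_cut:
  fixes lab glab :: "'v set \<Rightarrow> 'b" and bad :: "'v set \<Rightarrow> 'v set \<Rightarrow> real"
    and s :: "'v set" and K n :: nat
  defines "h \<equiv> \<lambda>z. avg (s \<union> z) n (bad z)"
  defines "\<eta> \<equiv> avg s K h"
  assumes s: "0 < wt s" "card s + K + n \<le> Suc d" and contr: "contr s K n M"
    and M: "0 \<le> M" "M \<le> 1/256" and \<eta>: "\<eta> \<le> 1/200"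
    and bad0: "\<And>z a. 0 \<le> bad z a" and bad1: "\<And>z a. lab z \<noteq> glab a \<Longrightarrow> bad z a = 1"
    and half: "avg s K (\<lambda>z. of_bool (h z \<le> 1/10 \<and> lab z \<in> T)) \<le> 1/2"
  shows "avg s K (\<lambda>z. of_bool (h z \<le> 1/10 \<and> lab z \<in> T)) \<le> 100 * (M * \<eta>)"
proof -
  define C where "C z = (of_bool (h z \<le> 1/10 \<and> lab z \<in> T) :: real)" for z
  define c where "c = avg s K C"
  define b where "b a = (of_bool (glab a \<in> T) :: real)" for a
  define Ca where "Ca a = avg (s \<union> a) K C" for a
  define B where "B = avg s n b"
  define Y where "Y = avg s n (\<lambda>a. b a * Ca a)"
  have fs: "finite s" using wt_posD(1)[OF s(1)] .
  have sn: "card s + n \<le> Suc d" and s': "card s + n + K \<le> Suc d"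
    using s(2) by auto
  have h0: "0 \<le> h z" for z unfolding h_def using bad0 by (intro avg_nonneg)
  have tow: "avg s n Ca = c" unfolding Ca_def c_def by (rule avg_tower[OF s])
  have c0: "0 \<le> c" unfolding c_def C_def by (intro avg_nonneg) simp
  have B0: "0 \<le> B" unfolding B_def b_def by (intro avg_nonneg) simp
  have B1: "B \<le> 1" unfolding B_def b_def by (intro avg_le_const[OF s(1) sn]) simp
  have "c - Y = avg s n (\<lambda>a. avg (s \<union> a) K (\<lambda>z. (1 - b a) * C z))"
    unfolding Y_def tow[symmetric] avg_diff[symmetric] avg_cmult
    by (intro avg_cong) (simp add: Ca_def algebra_simps)
  also have "\<dots> \<le> avg s n (\<lambda>a. avg (s \<union> a) K (\<lambda>z. C z * bad z a))"
  proof (intro avg_mono)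
    fix a z
    show "(1 - b a) * C z \<le> C z * bad z a"
      using bad0[of z a] bad1[of z a] by (cases "lab z = glab a") (auto simp: b_def C_def)
  qed
  also have "\<dots> = avg s K (\<lambda>z. avg (s \<union> z) n (\<lambda>a. C z * bad z a))"
    by (rule avg_swap[OF fs, symmetric])
  also have "\<dots> = avg s K (\<lambda>z. C z * h z)" by (simp add: avg_cmult h_def)
  also have "\<dots> \<le> avg s K (\<lambda>z. 1/10 * C z)"
    by (rule avg_mono) (auto simp: C_def)
  also have "\<dots> = 1/10 * c" unfolding c_def by (rule avg_cmult)
  finally have Y9: "9/10 * c \<le> Y" by simp
  have "B = avg s n (\<lambda>a. avg (s \<union> a) K (\<lambda>z. b a))"
    unfolding B_def
  proof (rule avg_cong)
    fix a assume a: "a \<in> lk s n" "0 < wt (s \<union> a)"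
    show "b a = avg (s \<union> a) K (\<lambda>z. b a)"
      by (rule avg_const[OF a(2), symmetric]) (use lkD[OF a(1)] fs s' in \<open>simp add: card_Un_disjoint\<close>)
  qed
  \<comment> \<open>If \<open>glab a \<in> T\<close>, then \<open>z\<close> lies in
    \<open>C\<close>, or \<open>h z > 1/10\<close> and the second term exceeds 1, or the labels
    differ and the pair is bad. Averaging gives the factor \<open>11 = 10 + 1\<close>.\<close>
  also have "\<dots> \<le> avg s n (\<lambda>a. avg (s \<union> a) K (\<lambda>z. (b a * C z + 10 * h z) + bad z a))"
  proof (intro avg_mono)
    fix a z
    show "b a \<le> (b a * C z + 10 * h z) + bad z a"
      using bad0[of z a] bad1[of z a] h0[of z] by (cases "lab z = glab a") (auto simp: b_def C_def)
  qed
  also have "\<dots> = (Y + 10 * \<eta>) + \<eta>"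
  proof -
    have "avg s n (\<lambda>a. avg (s \<union> a) K h) = \<eta>" unfolding \<eta>_def by (rule avg_tower[OF s])
    moreover have "avg s n (\<lambda>a. avg (s \<union> a) K (\<lambda>z. bad z a)) = \<eta>"
      unfolding \<eta>_def h_def by (rule avg_swap[OF fs, symmetric])
    ultimately show ?thesis unfolding avg_add avg_cmult by (simp add: Y_def Ca_def)
  qed
  finally have B11: "B \<le> 11 * \<eta> + Y" by simp
  have C2: "(C z)\<^sup>2 = C z" for z by (simp add: C_def)
  have b2: "(b a)\<^sup>2 = b a" for a by (simp add: b_def)
  \<comment> \<open>Expander mixing: the edge mass between the two sides deviates from
    \<open>B * c\<close> by an inner product of \<open>b\<close> with the centred \<open>Ca\<close>,
    whose variance is contracted by \<open>M\<close>.\<close>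
  have "Y - B * c = avg s n (\<lambda>a. b a * (Ca a - c))"
    unfolding Y_def B_def avg_cmult_right[symmetric] avg_diff[symmetric]
    by (rule avg_cong) (simp add: algebra_simps)
  then have "(Y - B * c)\<^sup>2 \<le> B * avg s n (\<lambda>a. (Ca a - c)\<^sup>2)"
    using avg_Cauchy_Schwarz[of s n b "\<lambda>a. Ca a - c"] by (simp add: b2 B_def)
  also have "\<dots> \<le> B * (M * c)"
  proof (rule mult_left_mono[OF _ B0])
    have "avg s n (\<lambda>a. (Ca a - c)\<^sup>2) \<le> M * (c - c\<^sup>2)"
      using contr_variance[OF contr s, of C] by (simp add: C2 Ca_def c_def)
    also have "\<dots> \<le> M * c" using M by (intro mult_left_mono) auto
    finally show "avg s n (\<lambda>a. (Ca a - c)\<^sup>2) \<le> M * c" .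
  qed
  finally have x: "(Y - B * c)\<^sup>2 \<le> B * (M * c)" .
  have "c \<le> 1/2" using half unfolding c_def C_def .
  from cut_arithmetic[OF Y9 B11 x c0 this B0 B1 M \<eta>] show ?thesis unfolding c_def C_def .
qed

text \<open>If one label has more than half of the good \<open>z\<close>-mass, the complement is a
  small cut. Otherwise every class is at most half and hence small, and classes are united one by
  one: two parts of mass at most \<open>1/4\<close> stay below \<open>1/2\<close>, so the cut bound
  applies again. In the end all good \<open>z\<close> together have small mass and any label
  works.\<close>

lemma majority_label:
  fixes lab glab :: "'v set \<Rightarrow> 'b" and bad :: "'v set \<Rightarrow> 'v set \<Rightarrow> real"
    and s :: "'v set" and K n :: nat
  defines "h \<equiv> \<lambda>z. avg (s \<union> z) n (bad z)"
  defines "\<eta> \<equiv> avg s K h"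
  assumes s: "0 < wt s" "card s + K + n \<le> Suc d" and contr: "contr s K n M"
    and M: "0 \<le> M" "M \<le> 1/256" and \<eta>: "\<eta> \<le> 1/200"
    and bad0: "\<And>z a. 0 \<le> bad z a" and bad1: "\<And>z a. lab z \<noteq> glab a \<Longrightarrow> bad z a = 1"
    and \<Sigma>: "finite \<Sigma>" "\<And>z. z \<in> lk s K \<Longrightarrow> 0 < wt (s \<union> z) \<Longrightarrow> lab z \<in> \<Sigma>"
  shows "\<exists>\<sigma>\<in>\<Sigma>. avg s K (\<lambda>z. of_bool (h z \<le> 1/10 \<and> lab z \<noteq> \<sigma>)) \<le> 100 * (M * \<eta>)"
proof -
  define c where "c T = avg s K (\<lambda>z. of_bool (h z \<le> 1/10 \<and> lab z \<in> T))" for T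
  have cut: "c T \<le> 100 * (M * \<eta>)" if "c T \<le> 1/2" for T
    unfolding c_def h_def \<eta>_def
  proof (rule small_cut[where glab = glab, OF s contr M])
    show "avg s K (\<lambda>z. avg (s \<union> z) n (bad z)) \<le> 1/200" using \<eta> unfolding \<eta>_def h_def .
    show "avg s K (\<lambda>z. of_bool (avg (s \<union> z) n (bad z) \<le> 1/10 \<and> lab z \<in> T)) \<le> 1/2"
      using that unfolding c_def h_def .
  qed (fact bad0 bad1)+
  have sK: "card s + K \<le> Suc d" using s(2) by simp
  \<comment> \<open>Supplies a label of \<open>\<Sigma>\<close> for the case without a
    majority.\<close>
  obtain z0 where "z0 \<in> lk s K" "0 < wt (s \<union> z0)"
    using avg_exists_le[OF s(1) sK, of "\<lambda>_. 0"] by blast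
  then have z0: "lab z0 \<in> \<Sigma>" using \<Sigma> by blast
  show ?thesis
  proof (cases "\<exists>\<sigma>\<in>\<Sigma>. c {\<sigma>} > 1/2")
    case True
    then obtain \<sigma> where \<sigma>: "\<sigma> \<in> \<Sigma>" "c {\<sigma>} > 1/2" by blast
    have "c (- {\<sigma>}) + c {\<sigma>} \<le> 1"
      unfolding c_def avg_add[symmetric] by (intro avg_le_const[OF s(1) sK]) auto
    then have "c (- {\<sigma>}) \<le> 100 * (M * \<eta>)" using \<sigma>(2) by (intro cut) simp
    then show ?thesis using \<sigma>(1) by (auto simp: c_def)
  next
    case False
    have small: "100 * (M * \<eta>) \<le> 1/4"
    proof -
      have "M * \<eta> \<le> M * (1/200)" using M \<eta> by (intro mult_left_mono)
      then show ?thesis using M by simp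
    qed
    have "c T \<le> 100 * (M * \<eta>)" if "T \<subseteq> \<Sigma>" for T
      using finite_subset[OF that \<Sigma>(1)] that
    proof (induction T rule: finite_induct)
      case empty
      show ?case by (rule cut) (simp add: c_def)
    next
      case (insert \<sigma> T)
      have "c {\<sigma>} \<le> 100 * (M * \<eta>)" using False insert.prems by (intro cut) auto
      moreover have "c (insert \<sigma> T) \<le> c {\<sigma>} + c T"
        unfolding c_def avg_add[symmetric] by (intro avg_mono) auto
      ultimately show ?case using insert small by (intro cut) auto
    qed
    then have "c \<Sigma> \<le> 100 * (M * \<eta>)" by simp
    moreover have "avg s K (\<lambda>z. of_bool (h z \<le> 1/10 \<and> lab z \<noteq> lab z0)) \<le> c \<Sigma>"
      unfolding c_def using \<Sigma>(2) by (intro avg_mono) auto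
    ultimately show ?thesis using z0 by (intro bexI[of _ "lab z0"]) auto
  qed
qed

end

section \<open>The agreement tests\<close>

context weighted_complex
begin

section \<open>Rejection and error probabilities as averages\<close>

lemma far_prob_avg:
  assumes d: "Suc k \<le> d"
  shows "far_prob w d l k f G = avg {} (Suc k) (\<lambda>z. of_bool
    (avg z 1 (\<lambda>x. of_bool (f z (the_elem x) \<noteq> G (the_elem x))) > 1 / real l))"
  unfolding far_prob_def sum_lev
proof (rule avg_cong)
  fix z assume z: "z \<in> lk {} (Suc k)" "0 < wt ({} \<union> z)"
  then have wz: "0 < wt z" by simp
  have b: "ball w z = verts (link w z)"
    using wt_pos_mono[of "insert v z" "{v}" for v]
    unfolding ball_def verts_link[OF wz] unfolding verts_def wt_pos_iff by auto
  have "(\<Sum>v\<in>ball w z. fprob (link w z) (d - card z) {v} * of_bool (f z v \<noteq> G v))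
      = avg z 1 (\<lambda>x. of_bool (f z (the_elem x) \<noteq> G (the_elem x)))"
    unfolding avg_vertices[OF wz] b
  proof (intro sum.cong refl)
    fix v assume "v \<in> verts (link w z)"
    then have "{v} \<inter> z = {}" using verts_link[OF wz] by auto
    then show "fprob (link w z) (d - card z) {v} * of_bool (f z v \<noteq> G v)
        = pr z 1 {v} * of_bool (f z (the_elem {v}) \<noteq> G (the_elem {v}))"
      using fprob_link[OF wz, of "{v}"] lkD[OF z(1)] d by simp
  qed
  then show "of_bool ((\<Sum>v\<in>ball w z. fprob (link w z) (d - card z) {v} * of_bool (f z v \<noteq> G v)) > 1 / real l)
    = of_bool (avg z 1 (\<lambda>x. of_bool (f z (the_elem x) \<noteq> G (the_elem x))) > 1 / real l)" by simp
qed

lemma rej_indep_avg: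
  assumes d: "Suc l \<le> d"
  shows "rej_indep w d l k f = avg {} (Suc l) (\<lambda>t. avg t (Suc k) (\<lambda>z1. avg t (Suc k)
    (\<lambda>z2. of_bool (\<exists>v\<in>t. f z1 v \<noteq> f z2 v))))"
  unfolding rej_indep_def sum_lev
proof (rule avg_cong)
  fix t assume t: "t \<in> lk {} (Suc l)" "0 < wt ({} \<union> t)"
  then have wt: "0 < wt t" and c: "card t \<le> d" using lkD[OF t(1)] d by auto
  show "(\<Sum>z1\<in>lev (link w t) k. \<Sum>z2\<in>lev (link w t) k.
      fprob (link w t) (d - card t) z1 * fprob (link w t) (d - card t) z2 * of_bool (\<exists>v\<in>t. f z1 v \<noteq> f z2 v))
    = avg t (Suc k) (\<lambda>z1. avg t (Suc k) (\<lambda>z2. of_bool (\<exists>v\<in>t. f z1 v \<noteq> f z2 v)))"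
    unfolding sum_lev_link[OF wt c, symmetric] by (simp add: sum_distrib_left mult.assoc)
qed

lemma rej_compl_avg:
  assumes d: "Suc l \<le> d"
  shows "rej_compl w d l k f = avg {} (Suc l) (\<lambda>t. avg t (Suc k) (\<lambda>z1. avg (t \<union> z1) (Suc k)
    (\<lambda>z2. of_bool (\<exists>v\<in>t. f z1 v \<noteq> f z2 v))))"
  unfolding rej_compl_def sum_lev
proof (rule avg_cong)
  fix t assume t: "t \<in> lk {} (Suc l)" "0 < wt ({} \<union> t)"
  then have wt: "0 < wt t" and c: "card t \<le> d" using lkD[OF t(1)] d by auto
  define F where "F z1 z2 = (of_bool (\<exists>v\<in>t. f z1 v \<noteq> f z2 v) :: real)" for z1 z2
  define b where "b = real ((2 * k + 2) choose (k + 1))"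
  have b: "b > 0" unfolding b_def of_nat_0_less_iff by (rule zero_less_binomial) simp
  \<comment> \<open>A face of dimension \<open>2 * k + 1\<close> has \<open>Suc k + Suc k\<close>
    vertices, so \<open>avg_marked\<close> applies and its binomial coefficient cancels the number
    \<open>b\<close> of ordered partitions.\<close>
  have e: "Suc k + Suc k = Suc (2 * k + 1)" "2 * k + 2 = Suc k + Suc k" "k + 1 = Suc k" by auto
  have "(\<Sum>u\<in>lev (link w t) (2 * k + 1). fprob (link w t) (d - card t) u *
        ((\<Sum>z1\<in>{z. z \<subseteq> u \<and> card z = Suc k}. F z1 (u - z1)) / b))
      = avg t (Suc (2 * k + 1)) (\<lambda>u. (\<Sum>z1\<in>{z. z \<subseteq> u \<and> card z = Suc k}. F z1 (u - z1)) / b)"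
    by (rule sum_lev_link[OF wt c])
  also have "\<dots> = (1 / b) * avg t (Suc k + Suc k) (\<lambda>u. \<Sum>z1\<in>{z. z \<subseteq> u \<and> card z = Suc k}. F z1 (u - z1))"
    unfolding avg_cmult[symmetric] e(1) by simp
  also have "\<dots> = avg t (Suc k) (\<lambda>z1. avg (t \<union> z1) (Suc k) (F z1))"
    unfolding avg_marked[OF wt_posD(1)[OF wt]] using b unfolding b_def e(2,3) by simp
  finally show "(\<Sum>u\<in>lev (link w t) (2 * k + 1). fprob (link w t) (d - card t) u *
        ((\<Sum>z1\<in>{z. z \<subseteq> u \<and> card z = Suc k}. of_bool (\<exists>v\<in>t. f z1 v \<noteq> f (u - z1) v))
          / real ((2 * k + 2) choose (k + 1))))
    = avg t (Suc k) (\<lambda>z1. avg (t \<union> z1) (Suc k) (\<lambda>z2. of_bool (\<exists>v\<in>t. f z1 v \<noteq> f z2 v)))"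
    unfolding F_def b_def .
qed

end

section \<open>From rejection probability to a global function\<close>

context link_expander
begin

text \<open>In the link of each \<open>t\<close>, the faces are classed by the restriction of their
  function to \<open>t\<close>. The complement walk there has \<open>\<mu> \<le> 1/2\<close>, so it
  detects at least half of the independent disagreement.\<close>

lemma rej_indep_le_rej_compl:
  assumes d: "l + 2 * k + 2 \<le> d" and small: "real (Suc k) * lam \<le> 1/2"
  shows "rej_indep w d l k f \<le> 2 * rej_compl w d l k f"
proof -
  have ld: "Suc l \<le> d" using d by simp
  have "rej_indep w d l k f \<le> avg {} (Suc l) (\<lambda>t. 2 * avg t (Suc k) (\<lambda>z1. avg (t \<union> z1) (Suc k)
    (\<lambda>z2. of_bool (\<exists>v\<in>t. f z1 v \<noteq> f z2 v))))"
    unfolding rej_indep_avg[OF ld]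
  proof (rule avg_mono)
    fix t assume t: "t \<in> lk {} (Suc l)" "0 < wt ({} \<union> t)"
    then have wt: "0 < wt t" and ct: "card t = Suc l" using lkD[OF t(1)] by auto
    define \<mu> where "\<mu> = real (Suc k) * lam"
    \<comment> \<open>Masking the values outside \<open>t\<close> makes disagreement somewhere on
      \<open>t\<close> the same as inequality of labels.\<close>
    define \<kappa> where "\<kappa> z v = (if v \<in> t then Some (f z v) else None)" for z v
    have \<kappa>: "(\<exists>v\<in>t. f z1 v \<noteq> f z2 v) \<longleftrightarrow> \<kappa> z1 \<noteq> \<kappa> z2" for z1 z2
      unfolding fun_eq_iff by (auto simp: \<kappa>_def)
    define I where "I = avg t (Suc k) (\<lambda>x. avg t (Suc k) (\<lambda>y. of_bool (\<kappa> x \<noteq> \<kappa> y)))"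
    define J where "J = avg t (Suc k) (\<lambda>x. avg (t \<union> x) (Suc k) (\<lambda>y. of_bool (\<kappa> x \<noteq> \<kappa> y)))"
    have cd: "card t + Suc k + Suc k \<le> Suc d" using ct d by simp
    have "contr t (Suc k) (Suc k) (\<mu>\<^sup>2)"
      using contr_faces[OF wt cd] by (simp add: \<mu>_def power2_eq_square mult_ac)
    then have "(1 - \<mu>) * I \<le> J"
      unfolding I_def J_def
      by (rule disagreement_complement_walk[OF wt cd]) (use lam in \<open>simp add: \<mu>_def\<close>)
    moreover have "1/2 * I \<le> (1 - \<mu>) * I"
    proof (rule mult_right_mono)
      show "1/2 \<le> 1 - \<mu>" using small by (simp add: \<mu>_def)
      show "0 \<le> I" unfolding I_def by (intro avg_nonneg) simp
    qed
    ultimately have "I \<le> 2 * J" by simp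
    then show "avg t (Suc k) (\<lambda>z1. avg t (Suc k) (\<lambda>z2. of_bool (\<exists>v\<in>t. f z1 v \<noteq> f z2 v)))
      \<le> 2 * avg t (Suc k) (\<lambda>z1. avg (t \<union> z1) (Suc k) (\<lambda>z2. of_bool (\<exists>v\<in>t. f z1 v \<noteq> f z2 v)))"
      unfolding I_def J_def \<kappa> .
  qed
  also have "\<dots> = 2 * rej_compl w d l k f"
    unfolding avg_cmult rej_compl_avg[OF ld] ..
  finally show ?thesis .
qed

text \<open>Here \<open>g\<close> is any reference assignment on the sets \<open>t\<close>. The
  frequency of bad pairs is tracked locally by \<open>h\<close>, per vertex by \<open>eta\<close>
  and per face by \<open>H\<close>. Both the cut bound and the concentration of \<open>eta\<close>
  gain a factor \<open>1 / L\<close>, and so does the deviation of \<open>h\<close> from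
  \<open>H\<close>; Markov at threshold \<open>1 / l\<close> spends it.\<close>

lemma far_prob_le_disagreement:
  fixes f g :: "'v set \<Rightarrow> 'v \<Rightarrow> 'a" and k l :: nat
  defines "no \<equiv> \<lambda>z t. of_bool (\<exists>v\<in>t. f z v \<noteq> g t v) :: real"
  defines "\<epsilon> \<equiv> avg {} (Suc l) (\<lambda>t. avg t (Suc k) (\<lambda>z. no z t))"
  assumes l: "4 \<le> l" and d: "l + 2 * k + 2 \<le> d"
    and lam_l: "lam \<le> 1 / real l" and M: "real (Suc k) * real l * lam\<^sup>2 \<le> 1 / (64 * real l)"
    and \<Sigma>: "finite \<Sigma>" and f: "\<forall>z\<in>lev w k. \<forall>v\<in>ball w z. f z v \<in> \<Sigma>"
    and \<epsilon>: "\<epsilon> \<le> 1/400"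
  shows "\<exists>G. (\<forall>v\<in>verts w. G v \<in> \<Sigma>) \<and> far_prob w d l k f G \<le> 400000 * \<epsilon>"
proof -
  define L where "L = real l"
  define K where "K = Suc k"
  define M' where "M' = real K * real l * lam\<^sup>2"
  have L4: "4 \<le> L" unfolding L_def using l by simp
  obtain l' where l': "l = Suc l'" using l by (cases l) auto
  have M0: "0 \<le> M'" unfolding M'_def by simp
  have M_le: "M' \<le> 1 / (64 * L)" using M unfolding M'_def L_def K_def .
  also have "\<dots> \<le> 1 / 256" using L4 by (simp add: divide_le_eq)
  finally have M256: "M' \<le> 1 / 256" .
  have lamL: "1 / real (Suc l) + lam \<le> 2 / L"
  proof -
    have "1 / real (Suc l) \<le> 1 / L" unfolding L_def using l by (simp add: frac_le)
    then show ?thesis using lam_l unfolding L_def by simp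
  qed
  have no01: "0 \<le> no z t" "no z t \<le> 1" "(no z t)\<^sup>2 = no z t" for z t unfolding no_def by auto
  have kd: "Suc k \<le> d" using d by simp
  have fin0: "finite {}" and wt0: "0 < wt {}" using wt_empty by auto
  have cl: "card {} + Suc l \<le> Suc d"
    using d by simp
  define h where "h z x = avg (z \<union> x) l (\<lambda>a. no z (x \<union> a))" for z x
  define eta where "eta x = avg x l (\<lambda>a. avg (x \<union> a) K (\<lambda>z. no z (x \<union> a)))" for x
  define H where "H z = avg z (Suc l) (no z)" for z
  have \<epsilon>K: "\<epsilon> = avg {} (Suc l) (\<lambda>t. avg t K (\<lambda>z. no z t))" unfolding \<epsilon>_def K_def ..
  have \<epsilon>0: "0 \<le> \<epsilon>" unfolding \<epsilon>_def using no01 by (intro avg_nonneg)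
  have H0: "0 \<le> H z" for z unfolding H_def using no01 by (intro avg_nonneg)
  have Hsum: "avg {} K H = \<epsilon>"
    unfolding \<epsilon>K H_def using avg_swap[OF fin0, of "Suc l" K "\<lambda>t z. no z t"] by simp
  have etasum: "avg {} 1 eta = \<epsilon>"
    unfolding \<epsilon>K eta_def using avg_split[OF fin0, of 1 l "\<lambda>t. avg t K (\<lambda>z. no z t)"] by simp
  have eta_dev: "avg {} 1 (\<lambda>x. (eta x - \<epsilon>)\<^sup>2) \<le> 2 / L * \<epsilon>"
  proof -
    have "avg {} 1 (\<lambda>x. (eta x - \<epsilon>)\<^sup>2)
        \<le> (1 / real (Suc l) + lam) * avg {} (Suc l) (\<lambda>t. (avg t K (\<lambda>z. no z t))\<^sup>2)"
      unfolding \<epsilon>K eta_def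
      using containment_variance[OF wt0 cl, of "\<lambda>t. avg t K (\<lambda>z. no z t)"] l by simp
    also have "\<dots> \<le> (1 / real (Suc l) + lam) * \<epsilon>"
    proof (rule mult_left_mono)
      show "avg {} (Suc l) (\<lambda>t. (avg t K (\<lambda>z. no z t))\<^sup>2) \<le> \<epsilon>"
        unfolding \<epsilon>K
      proof (rule avg_mono)
        fix t assume t: "t \<in> lk {} (Suc l)" "0 < wt ({} \<union> t)"
        have "card t + K \<le> Suc d" using lkD[OF t(1)] d by (simp add: K_def)
        then show "(avg t K (\<lambda>z. no z t))\<^sup>2 \<le> avg t K (\<lambda>z. no z t)"
          using avg_square_le[of t K "\<lambda>z. no z t"] t no01(3) by simp
      qed
      show "0 \<le> 1 / real (Suc l) + lam" using lam by simp
    qed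
    also have "\<dots> \<le> 2 / L * \<epsilon>" using lamL \<epsilon>0 by (rule mult_right_mono)
    finally show ?thesis .
  qed
  \<comment> \<open>Chebyshev: from \<open>\<epsilon> \<le> 1/400\<close>, an exceptional vertex
    deviates by at least \<open>1/400\<close>, and \<open>160000 = 400^2\<close>.\<close>
  have eta_large: "avg {} 1 (\<lambda>x. of_bool (eta x > 1/200)) \<le> 320000 / L * \<epsilon>"
  proof -
    have "avg {} 1 (\<lambda>x. of_bool (eta x > 1/200)) \<le> avg {} 1 (\<lambda>x. 160000 * (eta x - \<epsilon>)\<^sup>2)"
    proof (rule avg_mono)
      fix x
      show "of_bool (eta x > 1/200) \<le> 160000 * (eta x - \<epsilon>)\<^sup>2"
      proof (cases "eta x > 1/200")
        case True
        then have "1/400 \<le> eta x - \<epsilon>" using \<epsilon> by simp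
        then have "(1/400)\<^sup>2 \<le> (eta x - \<epsilon>)\<^sup>2" by (rule power_mono) simp
        then show ?thesis using True by (simp add: power2_eq_square)
      qed simp
    qed
    also have "\<dots> \<le> 160000 * (2 / L * \<epsilon>)" unfolding avg_cmult using eta_dev by simp
    finally show ?thesis by simp
  qed
  \<comment> \<open>For an ordinary vertex the label comes from \<open>majority_label\<close> in its
    link, with \<open>t = {v} \<union> a\<close>. For an exceptional one the last summand is 1, so
    any available label satisfies the bound.\<close>
  have "\<exists>\<sigma>\<in>\<Sigma>. avg {v} K (\<lambda>z. of_bool (h z {v} \<le> 1/10 \<and> f z v \<noteq> \<sigma>))
      \<le> 100 * (M' * eta {v}) + of_bool (eta {v} > 1/200)" if v: "v \<in> verts w" for v
  proof -
    have wv: "0 < wt {v}" using v unfolding verts_def wt_pos_iff by simp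
    have cv: "card {v} + K + l \<le> Suc d" and cvK: "card {v} + K \<le> Suc d" using d by (auto simp: K_def)
    have contr: "contr {v} K l M'"
      using contr_faces[OF wv, of k l'] cv unfolding M'_def K_def l' by simp
    define bad where "bad z a = no z ({v} \<union> a)" for z a
    have hb: "h z {v} = avg ({v} \<union> z) l (bad z)" for z
      unfolding h_def bad_def by (simp add: Un_commute)
    have etab: "eta {v} = avg {v} K (\<lambda>z. avg ({v} \<union> z) l (bad z))"
      unfolding eta_def bad_def by (rule avg_swap) simp
    have lab: "f z v \<in> \<Sigma>" if z: "z \<in> lk {v} K" "0 < wt ({v} \<union> z)" for z
    proof -
      have "0 < wt z" using wt_pos_mono[OF z(2)] by blast
      then have "z \<in> lev w k" using lkD[OF z(1)] unfolding lev_def wt_pos_iff K_def by simp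
      moreover have "v \<in> ball w z"
        using v lkD[OF z(1)] z(2) unfolding ball_def wt_pos_iff by (simp add: Un_commute)
      ultimately show ?thesis using f by blast
    qed
    show ?thesis
    proof (cases "eta {v} > 1/200")
      case False
      have "\<exists>\<sigma>\<in>\<Sigma>. avg {v} K (\<lambda>z. of_bool (avg ({v} \<union> z) l (bad z) \<le> 1/10 \<and> f z v \<noteq> \<sigma>))
          \<le> 100 * (M' * avg {v} K (\<lambda>z. avg ({v} \<union> z) l (bad z)))"
      proof (rule majority_label[where glab = "\<lambda>a. g ({v} \<union> a) v", OF wv cv contr M0 M256])
        show "avg {v} K (\<lambda>z. avg ({v} \<union> z) l (bad z)) \<le> 1/200" using False etab by simp
        show "0 \<le> bad z a" for z a unfolding bad_def by (rule no01)
        show "bad z a = 1" if "f z v \<noteq> g ({v} \<union> a) v" for z a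
          using that unfolding bad_def no_def by simp
      qed (use \<Sigma> lab in auto)
      then show ?thesis unfolding hb etab[symmetric] using False by simp
    next
      case True
      obtain z where "z \<in> lk {v} K" "0 < wt ({v} \<union> z)"
        using avg_exists_le[OF wv cvK, of "\<lambda>_. 0"] by blast
      then have "f z v \<in> \<Sigma>" by (rule lab)
      moreover have "avg {v} K (\<lambda>z'. of_bool (h z' {v} \<le> 1/10 \<and> f z' v \<noteq> f z v)) \<le> 1"
        by (rule avg_le_const[OF wv cvK]) simp
      moreover have "0 \<le> M' * eta {v}" using M0 True by simp
      ultimately show ?thesis using True by (intro bexI[of _ "f z v"]) auto
    qed
  qed
  then have "\<forall>v\<in>verts w. \<exists>\<sigma>. \<sigma> \<in> \<Sigma> \<and> avg {v} K (\<lambda>z. of_bool (h z {v} \<le> 1/10 \<and> f z v \<noteq> \<sigma>))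
      \<le> 100 * (M' * eta {v}) + of_bool (eta {v} > 1/200)" by blast
  from bchoice[OF this] obtain G where G: "\<And>v. v \<in> verts w \<Longrightarrow> G v \<in> \<Sigma>"
    "\<And>v. v \<in> verts w \<Longrightarrow> avg {v} K (\<lambda>z. of_bool (h z {v} \<le> 1/10 \<and> f z v \<noteq> G v))
      \<le> 100 * (M' * eta {v}) + of_bool (eta {v} > 1/200)" by blast
  \<comment> \<open>Only errors at vertices where \<open>z\<close> has few bad \<open>t\<close> are
    counted here; the others are charged to the deviation of \<open>h z x\<close> from
    \<open>H z\<close>.\<close>
  define err where "err z x = (of_bool (h z x \<le> 1/10 \<and> f z (the_elem x) \<noteq> G (the_elem x)) :: real)" for z x
  define Q where "Q z = avg z 1 (err z)" for z
  have err0: "0 \<le> err z x" for z x unfolding err_def by simp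
  have Q0: "0 \<le> Q z" for z unfolding Q_def by (intro avg_nonneg err0)
  have Qsum: "avg {} K Q \<le> 320002 / L * \<epsilon>"
  proof -
    have "avg {} K Q = avg {} 1 (\<lambda>x. avg x K (\<lambda>z. err z x))"
      unfolding Q_def using avg_swap[OF fin0, of K 1 err] by simp
    also have "\<dots> \<le> avg {} 1 (\<lambda>x. (100 * M') * eta x + of_bool (eta x > 1/200))"
    proof (rule avg_mono)
      fix x assume x: "x \<in> lk {} 1" "0 < wt ({} \<union> x)"
      then obtain v where v: "x = {v}" using lkD[OF x(1)] card_1_singletonE by metis
      then have "v \<in> verts w" using x(2) unfolding verts_def wt_pos_iff by simp
      from G(2)[OF this]
      show "avg x K (\<lambda>z. err z x) \<le> (100 * M') * eta x + of_bool (eta x > 1/200)"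
        unfolding v err_def by simp
    qed
    also have "\<dots> \<le> (100 * M') * \<epsilon> + 320000 / L * \<epsilon>"
      unfolding avg_add avg_cmult etasum using eta_large by simp
    also have "(100 * M') * \<epsilon> \<le> (2 / L) * \<epsilon>"
    proof (rule mult_right_mono[OF _ \<epsilon>0])
      have "100 * M' \<le> 100 * (1 / (64 * L))" using M_le by simp
      also have "\<dots> \<le> 2 / L" using L4 by (simp add: divide_simps)
      finally show "100 * M' \<le> 2 / L" .
    qed
    finally show ?thesis by (simp add: add_divide_distrib[symmetric] distrib_right[symmetric])
  qed
  have "far_prob w d l k f G \<le> avg {} K (\<lambda>z. L * Q z + 820 * H z)"
    unfolding far_prob_avg[OF kd] K_def[symmetric]
  proof (rule avg_mono)
    fix z assume z: "z \<in> lk {} K" "0 < wt ({} \<union> z)"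
    then have wz: "0 < wt z" and cz: "card z = K" using lkD[OF z(1)] by auto
    have czl: "card z + Suc l \<le> Suc d" using d cz by (auto simp: K_def)
    define D where "D = avg z 1 (\<lambda>x. of_bool (f z (the_elem x) \<noteq> G (the_elem x)))"
    show "of_bool (1 / real l < avg z 1 (\<lambda>x. of_bool (f z (the_elem x) \<noteq> G (the_elem x)))) \<le> L * Q z + 820 * H z"
    \<comment> \<open>A large \<open>H z\<close> already makes \<open>820 * H z\<close> exceed 1.
      Otherwise \<open>h z x > 1/10\<close> is a deviation of at least \<open>1/20\<close>, whence
      the factor \<open>400 = 20^2\<close>.\<close>
    proof (cases "H z > 1/20")
      case True
      have "0 \<le> L * Q z" using L4 Q0 by simp
      then show ?thesis using True by simp
    next
      case False
      have dev: "avg z 1 (\<lambda>x. (h z x - H z)\<^sup>2) \<le> 2 / L * H z"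
      proof -
        have "avg z 1 (\<lambda>x. (h z x - H z)\<^sup>2) \<le> (1 / real (Suc l) + lam) * H z"
          unfolding h_def H_def using containment_variance[OF wz czl, of "no z"] l no01(3) by simp
        also have "\<dots> \<le> 2 / L * H z" using lamL H0 by (rule mult_right_mono)
        finally show ?thesis .
      qed
      have "D \<le> avg z 1 (\<lambda>x. err z x + 400 * (h z x - H z)\<^sup>2)"
        unfolding D_def
      proof (rule avg_mono)
        fix x
        show "of_bool (f z (the_elem x) \<noteq> G (the_elem x)) \<le> err z x + 400 * (h z x - H z)\<^sup>2"
        proof (cases "h z x \<le> 1/10")
          case True
          then show ?thesis by (simp add: err_def)
        next
          case h10: False
          then have "1/20 \<le> h z x - H z" using False by simp
          then have "(1/20)\<^sup>2 \<le> (h z x - H z)\<^sup>2" by (rule power_mono) simp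
          then have "1 \<le> 400 * (h z x - H z)\<^sup>2" by (simp add: power2_eq_square)
          moreover have "of_bool (f z (the_elem x) \<noteq> G (the_elem x)) \<le> (1::real)" by simp
          ultimately show ?thesis using err0[of z x] by linarith
        qed
      qed
      also have "\<dots> \<le> Q z + 400 * (2 / L * H z)"
        unfolding avg_add avg_cmult Q_def using dev by simp
      finally have "L * D \<le> L * (Q z + 400 * (2 / L * H z))" using L4 by (intro mult_left_mono) auto
      also have "\<dots> = L * Q z + 800 * H z" using L4 by (simp add: field_simps)
      finally have LD: "L * D \<le> L * Q z + 800 * H z" .
      have "0 \<le> L * Q z + 800 * H z" using L4 Q0[of z] H0[of z] by simp
      moreover have "1 < L * D" if "1 / real l < D" using that L4 by (simp add: L_def field_simps)
      ultimately show ?thesis using LD H0[of z] unfolding D_def[symmetric] by (cases "1 / real l < D") auto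
    qed
  qed
  also have "\<dots> = L * avg {} K Q + 820 * \<epsilon>" by (simp add: avg_add avg_cmult Hsum)
  also have "L * avg {} K Q \<le> L * (320002 / L * \<epsilon>)" using Qsum L4 by (intro mult_left_mono) auto
  also have "L * (320002 / L * \<epsilon>) = 320002 * \<epsilon>" using L4 by simp
  finally have "far_prob w d l k f G \<le> 400000 * \<epsilon>" using \<epsilon>0 by simp
  then show ?thesis using G(1) by blast
qed

text \<open>The reference on \<open>t\<close> is \<open>f (z0 t)\<close> for a face
  \<open>z0 t\<close> that disagrees with a random \<open>z\<close> at most as often as two
  independent faces do; such a face exists by averaging.\<close>

lemma far_prob_le_rej_indep:
  fixes f :: "'v set \<Rightarrow> 'v \<Rightarrow> 'a"
  assumes l: "4 \<le> l" and d: "l + 2 * k + 2 \<le> d"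
    and lam_l: "lam \<le> 1 / real l" and M: "real (Suc k) * real l * lam\<^sup>2 \<le> 1 / (64 * real l)"
    and \<Sigma>: "finite \<Sigma>" and f: "\<forall>z\<in>lev w k. \<forall>v\<in>ball w z. f z v \<in> \<Sigma>"
  shows "\<exists>G. (\<forall>v\<in>verts w. G v \<in> \<Sigma>) \<and> far_prob w d l k f G \<le> 400000 * rej_indep w d l k f"
proof -
  define I where "I t = avg t (Suc k) (\<lambda>z1. avg t (Suc k) (\<lambda>z2. of_bool (\<exists>v\<in>t. f z1 v \<noteq> f z2 v)))" for t
  have rej: "rej_indep w d l k f = avg {} (Suc l) I"
    unfolding I_def by (rule rej_indep_avg) (use d in simp)
  have "\<exists>u. avg t (Suc k) (\<lambda>z. of_bool (\<exists>v\<in>t. f z v \<noteq> f u v)) \<le> I t"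
    if t: "t \<in> lk {} (Suc l)" "0 < wt t" for t
  proof -
    have "card t + Suc k \<le> Suc d" using lkD[OF t(1)] d by simp
    from avg_exists_le[OF t(2) this, of "\<lambda>u. avg t (Suc k) (\<lambda>z. of_bool (\<exists>v\<in>t. f u v \<noteq> f z v))"]
    obtain u where "avg t (Suc k) (\<lambda>z. of_bool (\<exists>v\<in>t. f u v \<noteq> f z v)) \<le> I t"
      unfolding I_def by blast
    moreover have "(\<exists>v\<in>t. f u v \<noteq> f z v) \<longleftrightarrow> (\<exists>v\<in>t. f z v \<noteq> f u v)" for z by metis
    ultimately show ?thesis by auto
  qed
  then have "\<forall>t\<in>{t \<in> lk {} (Suc l). 0 < wt t}. \<exists>u.
      avg t (Suc k) (\<lambda>z. of_bool (\<exists>v\<in>t. f z v \<noteq> f u v)) \<le> I t" by blast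
  from bchoice[OF this] obtain z0 where z0: "\<And>t. t \<in> lk {} (Suc l) \<Longrightarrow> 0 < wt t \<Longrightarrow>
      avg t (Suc k) (\<lambda>z. of_bool (\<exists>v\<in>t. f z v \<noteq> f (z0 t) v)) \<le> I t" by blast
  define \<epsilon> where "\<epsilon> = avg {} (Suc l) (\<lambda>t. avg t (Suc k) (\<lambda>z. of_bool (\<exists>v\<in>t. f z v \<noteq> f (z0 t) v)))"
  have \<epsilon>: "\<epsilon> \<le> rej_indep w d l k f"
    unfolding \<epsilon>_def rej using z0 by (intro avg_mono) simp
  show ?thesis
  proof (cases "\<epsilon> \<le> 1/400")
    case True
    from far_prob_le_disagreement[OF l d lam_l M \<Sigma> f, of "\<lambda>t. f (z0 t)"] True
    obtain G where "\<forall>v\<in>verts w. G v \<in> \<Sigma>" "far_prob w d l k f G \<le> 400000 * \<epsilon>"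
      unfolding \<epsilon>_def by blast
    then show ?thesis using \<epsilon> by (intro exI[of _ G]) auto
  next
    case False
    \<comment> \<open>The right-hand side now exceeds 1, so any \<open>G\<close> into
      \<open>\<Sigma>\<close> works. A vertex extends to a face, which shows that
      \<open>\<Sigma>\<close> has an element.\<close>
    have "\<exists>\<sigma>. \<sigma> \<in> \<Sigma>" if v: "v \<in> verts w" for v
    proof -
      have wv: "0 < wt {v}" using v unfolding verts_def wt_pos_iff by simp
      have "card {v} + Suc k \<le> Suc d" using d by simp
      from avg_exists_le[OF wv this, of "\<lambda>_. 0"]
      obtain z where z: "z \<in> lk {v} (Suc k)" "0 < wt ({v} \<union> z)" by blast
      have "0 < wt z" using wt_pos_mono[OF z(2)] by blast
      then have "z \<in> lev w k" using lkD[OF z(1)] unfolding lev_def wt_pos_iff by simp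
      moreover have "v \<in> ball w z"
        using v lkD[OF z(1)] z(2) unfolding ball_def wt_pos_iff by (simp add: Un_commute)
      ultimately show ?thesis using f by blast
    qed
    then have "\<forall>v\<in>verts w. \<exists>\<sigma>. \<sigma> \<in> \<Sigma>" by blast
    from bchoice[OF this] obtain G where G: "\<forall>v\<in>verts w. G v \<in> \<Sigma>" by blast
    have kd: "Suc k \<le> d" using d by simp
    have "far_prob w d l k f G \<le> 1"
      unfolding far_prob_avg[OF kd]
      by (rule avg_le_const) (use d wt_empty in auto)
    then show ?thesis using G False \<epsilon> by (intro exI[of _ G]) auto
  qed
qed

end

theorem theorem5p3:
  "\<exists>c::real. c > 0 \<and>
     (\<forall>(l::nat) (k::nat) (d::nat) (w :: 'v set \<Rightarrow> real) (\<Sigma> :: 'a set) (f :: 'v set \<Rightarrow> 'v \<Rightarrow> 'a).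
        4 \<le> l \<longrightarrow> real l \<le> (real d - 2) / 2 \<longrightarrow> l + 2 * k + 2 \<le> d \<longrightarrow>
        wcomplex w d \<longrightarrow>
        two_sided_link_expander w d (1 / (real l * (real k + real l)^2)) \<longrightarrow>
        finite \<Sigma> \<longrightarrow>
        (\<forall>z\<in>lev w k. \<forall>v\<in>ball w z. f z v \<in> \<Sigma>) \<longrightarrow>
        (\<forall>\<epsilon>\<in>{rej_indep w d l k f, rej_compl w d l k f}.
           \<exists>G. (\<forall>v\<in>verts w. G v \<in> \<Sigma>) \<and> far_prob w d l k f G \<le> c * \<epsilon>))"
\<comment> \<open>Twice the constant of the independent test, because the complement test may reject
  half as often.\<close>
proof (intro exI[of _ 800000] conjI allI impI)
  fix l k d :: nat and w :: "'v set \<Rightarrow> real" and \<Sigma> :: "'a set" and f :: "'v set \<Rightarrow> 'v \<Rightarrow> 'a"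
  assume l: "4 \<le> l" and d: "l + 2 * k + 2 \<le> d" and wc: "wcomplex w d"
    and ex: "two_sided_link_expander w d (1 / (real l * (real k + real l)^2))"
    and \<Sigma>: "finite \<Sigma>" and f: "\<forall>z\<in>lev w k. \<forall>v\<in>ball w z. f z v \<in> \<Sigma>"
  define S where "S = real k + real l"
  define lam where "lam = 1 / (real l * S\<^sup>2)"
  have L: "4 \<le> real l" using l by simp
  have S4: "4 \<le> S" and kS: "real (Suc k) \<le> S" unfolding S_def using l by auto
  have S16: "4\<^sup>2 \<le> S\<^sup>2" using S4 by (intro power_mono) auto
  have Sl: "lam * real l = 1 / S\<^sup>2" unfolding lam_def using L by simp
  have S2: "1 / S\<^sup>2 \<le> 1 / 4\<^sup>2" using S16 by (intro divide_left_mono) auto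
  have lam0: "0 < lam" unfolding lam_def using L S4 by simp
  have lam_l: "lam \<le> 1 / real l"
  proof -
    have "lam * real l \<le> 1" unfolding Sl using S2 by simp
    then show ?thesis using L by (simp add: le_divide_eq)
  qed
  have "1 / real l \<le> 1/4" using L by (simp add: divide_simps)
  then have lam1: "lam < 1" using lam_l by simp
  \<comment> \<open>Of the two factors \<open>S\<close> in the denominator of \<open>lam\<close>,
    one pays for \<open>Suc k\<close> and the other gives \<open>1/4\<close>.\<close>
  have kl: "real (Suc k) * lam \<le> 1 / (4 * real l)"
  proof -
    have "real (Suc k) * lam * real l \<le> S * (1 / S\<^sup>2)"
      unfolding mult.assoc Sl by (rule mult_right_mono[OF kS]) simp
    also have "\<dots> = 1 / S" using S4 by (simp add: power2_eq_square)
    also have "\<dots> \<le> 1 / 4" using S4 by (intro divide_left_mono) auto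
    finally show ?thesis using L by (simp add: field_simps)
  qed
  have "real (Suc k) * lam \<le> 1/2"
  proof -
    have "1 / (4 * real l) \<le> 1/2" using L by (simp add: divide_simps)
    then show ?thesis using kl by simp
  qed
  \<comment> \<open>One factor \<open>lam\<close> absorbs \<open>Suc k\<close> and leaves
    \<open>1 / l\<close>, the gain of the cut argument; the other absorbs
    \<open>real l\<close>.\<close>
  have M: "real (Suc k) * real l * lam\<^sup>2 \<le> 1 / (64 * real l)"
  proof -
    have "real (Suc k) * real l * lam\<^sup>2 = (real (Suc k) * lam) * (lam * real l)"
      by (simp add: power2_eq_square)
    also have "\<dots> \<le> (1 / (4 * real l)) * (1 / 16)"
      using kl S2 lam0 L unfolding Sl by (intro mult_mono) auto
    finally show ?thesis by simp
  qed
  interpret link_expander w d lam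
    by unfold_locales (use wc ex lam0 lam1 in \<open>auto simp: lam_def S_def\<close>)
  obtain G where G: "\<forall>v\<in>verts w. G v \<in> \<Sigma>" "far_prob w d l k f G \<le> 400000 * rej_indep w d l k f"
    using far_prob_le_rej_indep[OF l d lam_l M \<Sigma> f] by blast
  have le: "rej_indep w d l k f \<le> 2 * rej_compl w d l k f"
    by (rule rej_indep_le_rej_compl[OF d]) fact
  have "0 \<le> rej_indep w d l k f"
    by (subst rej_indep_avg) (use d in \<open>auto intro!: avg_nonneg\<close>)
  then have "\<forall>\<epsilon>\<in>{rej_indep w d l k f, rej_compl w d l k f}. far_prob w d l k f G \<le> 800000 * \<epsilon>"
    using G(2) le by auto
  then show "\<forall>\<epsilon>\<in>{rej_indep w d l k f, rej_compl w d l k f}.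
      \<exists>G. (\<forall>v\<in>verts w. G v \<in> \<Sigma>) \<and> far_prob w d l k f G \<le> 800000 * \<epsilon>"
    using G(1) by blast
qed simp

end
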